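(* Let $p$ be a prime, let $G$ be a finite $p$-solvable group and let $P$ be a Sylow $p$-subgroup of $G$. The intersection of the kernels of the irreducible complex characters of $G$ of degree not divisible by $p$ is the largest normal subgroup $N$ of $G$ such that $\mathbf{N}_N(P)$ is contained in $P'$.
   Context: Here $\mathbf{N}_N(P)=\{x\in N : P^x=P\}$ and $P'$ is the derived (commutator) subgroup of $P$. "Largest" means that $N$ has the property and contains every normal subgroup of $G$ with the property. *)

theory Defs
  imports
    "HOL-Algebra.Algebra"
    "Jordan_Normal_Form.VS_Connect"
begin

text \<open>A series of normal subgroups of \<open>G\<close> (all normal in \<open>G\<close>), each of whose factors
  is a \<open>p\<close>-group or a \<open>p'\<close>-group. Only used for finite groups.\<close>

definition p_solvable :: "nat \<Rightarrow> ('a, 'b) monoid_scheme \<Rightarrow> bool" where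
  "p_solvable p G \<longleftrightarrow> (\<exists>(r::nat) H.
     H 0 = {\<one>\<^bsub>G\<^esub>} \<and> H r = carrier G \<and>
     (\<forall>i\<le>r. H i \<lhd> G) \<and>
     (\<forall>i<r. H i \<subseteq> H (Suc i) \<and>
       ((\<exists>k. Coset.order (G\<lparr>carrier := H (Suc i)\<rparr> Mod H i) = p ^ k) \<or>
        \<not> p dvd Coset.order (G\<lparr>carrier := H (Suc i)\<rparr> Mod H i))))"

definition sylow_subgroup :: "nat \<Rightarrow> 'a set \<Rightarrow> ('a, 'b) monoid_scheme \<Rightarrow> bool" where
  "sylow_subgroup p P G \<longleftrightarrow> subgroup P G \<and> card P = p ^ multiplicity p (Coset.order G)"

text \<open>The library normalizer is taken with respect to \<open>g P g\<inverse>\<close>; here is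
  \<open>N \<inter> normalizer G P\<close> in terms of \<open>P\<^sup>x = x\<inverse> P x\<close>.\<close>

lemma (in group) Int_normalizer_eq:
  assumes "N \<subseteq> carrier G" and "P \<subseteq> carrier G"
  shows "N \<inter> normalizer G P = {x \<in> N. inv x <# P #> x = P}"
proof -
  have "x <# P #> inv x = P \<longleftrightarrow> inv x <# P #> x = P" if x: "x \<in> carrier G" for x
  proof -
    have conj: "y <# (inv y <# P #> y) #> inv y = P" if y: "y \<in> carrier G" for y
    proof -
      have sub: "inv y <# P \<subseteq> carrier G"
        using y assms(2) by (auto simp: l_coset_def)
      have "y <# (inv y <# P #> y) = (y <# (inv y <# P)) #> y"
        using coset_assoc y sub by metis
      also have "\<dots> = P #> y"
        using y assms(2) by (simp add: lcos_m_assoc lcos_mult_one)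
      finally show ?thesis
        using y assms(2) by (simp add: coset_mult_assoc)
    qed
    show ?thesis
      using conj[OF x] conj[of "inv x"] x by auto
  qed
  then show ?thesis
    using assms unfolding normalizer_def stabilizer_def by auto
qed

definition representation ::
  "('a, 'b) monoid_scheme \<Rightarrow> nat \<Rightarrow> ('a \<Rightarrow> complex mat) \<Rightarrow> bool" where
  "representation G n \<rho> \<longleftrightarrow> \<rho> \<in> hom G (units_of (ring_mat TYPE(complex) n ()))"

definition irreducible_representation ::
  "('a, 'b) monoid_scheme \<Rightarrow> nat \<Rightarrow> ('a \<Rightarrow> complex mat) \<Rightarrow> bool" where
  "irreducible_representation G n \<rho> \<longleftrightarrow>
     representation G n \<rho> \<and> n > 0 \<and>
     (\<forall>W. VectorSpace.subspace class_ring W (module_vec TYPE(complex) n) \<and>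
          (\<forall>g \<in> carrier G. \<forall>w \<in> W. \<rho> g *\<^sub>v w \<in> W)
        \<longrightarrow> W = {0\<^sub>v n} \<or> W = carrier_vec n)"

definition mat_trace :: "complex mat \<Rightarrow> complex" where
  "mat_trace A = (\<Sum>i<dim_row A. A $$ (i, i))"

text \<open>Characters are extensional (\<open>undefined\<close> off \<open>carrier G\<close>).\<close>

definition character_of ::
  "('a, 'b) monoid_scheme \<Rightarrow> ('a \<Rightarrow> complex mat) \<Rightarrow> 'a \<Rightarrow> complex" where
  "character_of G \<rho> = (\<lambda>g \<in> carrier G. mat_trace (\<rho> g))"

definition Irr :: "('a, 'b) monoid_scheme \<Rightarrow> ('a \<Rightarrow> complex) set" where
  "Irr G = {character_of G \<rho> | \<rho> n. irreducible_representation G n \<rho>}"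

definition char_degree :: "('a, 'b) monoid_scheme \<Rightarrow> ('a \<Rightarrow> complex) \<Rightarrow> nat" where
  "char_degree G \<chi> = (THE n. \<chi> \<one>\<^bsub>G\<^esub> = of_nat n)"

definition char_kernel :: "('a, 'b) monoid_scheme \<Rightarrow> ('a \<Rightarrow> complex) \<Rightarrow> 'a set" where
  "char_kernel G \<chi> = {g \<in> carrier G. \<chi> g = \<chi> \<one>\<^bsub>G\<^esub>}"

lemma (in group) char_degree_character_of:
  assumes "representation G n \<rho>"
  shows "char_degree G (character_of G \<rho>) = n"
proof -
  let ?M = "ring_mat TYPE(complex) n ()"
  have \<rho>: "\<rho> \<in> hom G (units_of ?M)"
    using assms by (simp add: representation_def)
  have "ring ?M"
    by (rule ring_mat)
  then have "group (units_of ?M)"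
    by (intro monoid.units_group ring.is_monoid)
  then have "group_hom G (units_of ?M) \<rho>"
    using \<rho> by (simp add: group_hom_def group_hom_axioms_def is_group)
  then have "\<rho> \<one> = 1\<^sub>m n"
    using group_hom.hom_one by (fastforce simp: units_of_def ring_mat_def)
  then show ?thesis
    by (simp add: char_degree_def character_of_def mat_trace_def)
qed

definition largest_normal_subgroup ::
  "('a, 'b) monoid_scheme \<Rightarrow> ('a set \<Rightarrow> bool) \<Rightarrow> 'a set \<Rightarrow> bool" where
  "largest_normal_subgroup G Q M \<longleftrightarrow> M \<lhd> G \<and> Q M \<and> (\<forall>N. N \<lhd> G \<and> Q N \<longrightarrow> N \<subseteq> M)"

end

theory Submission
  imports
    Defs
    "Jordan_Normal_Form.Spectral_Radius"
begin

text \<open>Call \<open>K\<close> the intersection of the kernels. Everything is read off from sums \<open>\<Sum>x\<in>N. \<chi> x\<close> over a normal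
subgroup \<open>N\<close>. If such a sum is nonzero, then \<open>N\<close> fixes a nonzero vector of a module affording \<open>\<chi>\<close>
(\<open>trace_sum_fixed_vector\<close>); if moreover the module is irreducible, then \<open>N\<close> acts trivially, because the
vectors fixed by \<open>N\<close> form a submodule (\<open>irreducible_fixed_vector\<close>). So for irreducible \<open>\<chi>\<close> the sum is
either \<open>0\<close> or \<open>card N\<close> times the degree, and a character of degree prime to \<open>p\<close> has a nonzero sum as soon
as \<open>N\<close> is killed by all irreducible representations of degree prime to \<open>p\<close>: one of its composition
factors is such a representation (\<open>normal_trace_sum_nonzero\<close>).

\<^bold>\<open>The intersection has the property.\<close> Let \<open>H\<close> be a subgroup containing \<open>P\<close> and \<open>\<theta>\<close> a linear character
of \<open>H\<close>. The induced character has degree \<open>|G : H|\<close>, prime to \<open>p\<close>, so its sum over \<open>K\<close> is nonzero. But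
that sum is \<open>|G : H|\<close> times the sum of \<open>\<theta>\<close> over \<open>K \<inter> H\<close>, which vanishes unless \<open>\<theta>\<close> is trivial
on \<open>K \<inter> H\<close>. Hence \<open>\<theta>\<close> is trivial there (\<open>linear_character_trivial\<close>). For \<open>x\<close> in \<open>K\<close> normalizing \<open>P\<close>,
the characters of the cyclic group \<open>P\<langle>x\<rangle>/P\<close> give \<open>x \<in> P\<close>, and then those of \<open>P/P'\<close> give \<open>x \<in> P'\<close>.

\<^bold>\<open>It contains every normal subgroup with the property.\<close> Let \<open>N\<close> be one and let \<open>V\<close> be irreducible of
degree prime to \<open>p\<close>. Intersect \<open>N\<close> with a series as in the definition of \<open>p\<close>-solvability and climb:
assume that \<open>A\<close> acts trivially on \<open>V\<close> and that \<open>B/A\<close> is the next section.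

If \<open>B/A\<close> is a \<open>p\<close>-group, then \<open>B = A(P \<inter> B)\<close> and \<open>P \<inter> B \<subseteq> P'\<close>. The restriction of \<open>V\<close> to \<open>P\<close> has a
composition factor of degree prime to \<open>p\<close>, on which \<open>P'\<close> acts trivially
(\<open>p_group_irreducible_derived\<close>), so \<open>P \<inter> B\<close>, and with it \<open>B\<close>, fixes a nonzero vector.

If \<open>B/A\<close> has order prime to \<open>p\<close>, let \<open>P\<close> act by conjugation on the finite group of matrices afforded
by \<open>B\<close>. By Sylow conjugacy a fixed point of this action comes from an element of \<open>B\<close> that normalizes \<open>P\<close>;
that element lies in \<open>P \<inter> B\<close>, hence acts trivially. The identity is thus the only fixed point, and the
sum of the traces of these matrices is congruent modulo \<open>p\<close>, in a ring of algebraic integers, to the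
trace of the identity, that is, to the degree. So it is not zero, and \<open>B\<close> fixes a nonzero vector.\<close>

section \<open>Traces and matrices of finite order\<close>

lemma mat_trace_mult_comm:
  assumes "A \<in> carrier_mat n m" and "B \<in> carrier_mat m n"
  shows "mat_trace (A * B) = mat_trace (B * A)"
proof -
  have "mat_trace (A * B) = (\<Sum>i<n. \<Sum>j<m. A $$ (i,j) * B $$ (j,i))"
    using assms by (auto simp: mat_trace_def scalar_prod_def atLeast0LessThan intro!: sum.cong)
  also have "\<dots> = (\<Sum>j<m. \<Sum>i<n. B $$ (j,i) * A $$ (i,j))"
    by (subst sum.swap) (simp add: mult.commute)
  also have "\<dots> = mat_trace (B * A)"
    using assms by (auto simp: mat_trace_def scalar_prod_def atLeast0LessThan intro!: sum.cong)
  finally show ?thesis .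
qed

lemma mat_trace_one: "mat_trace (1\<^sub>m n) = of_nat n"
  by (simp add: mat_trace_def)

lemma mat_trace_conj:
  assumes "A \<in> carrier_mat n n" "P \<in> carrier_mat n n" "Q \<in> carrier_mat n n" "Q * P = 1\<^sub>m n"
  shows "mat_trace (P * A * Q) = mat_trace A"
proof -
  have "mat_trace (P * A * Q) = mat_trace (Q * (P * A))"
    using assms by (intro mat_trace_mult_comm) auto
  also have "Q * (P * A) = A"
    using assms by (simp add: assoc_mult_mat[symmetric, of _ n n _ n _ n])
  finally show ?thesis .
qed

lemma upper_triangular_mult_diag:
  fixes A B :: "complex mat"
  assumes A: "A \<in> carrier_mat n n" "upper_triangular A"
    and B: "B \<in> carrier_mat n n" "upper_triangular B"
  shows "upper_triangular (A * B)"
    and "i < n \<Longrightarrow> (A * B) $$ (i,i) = A $$ (i,i) * B $$ (i,i)"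
proof -
  have entry: "(A * B) $$ (i,j) = (\<Sum>k<n. A $$ (i,k) * B $$ (k,j))" if "i < n" "j < n" for i j
    using that A B by (auto simp: scalar_prod_def atLeast0LessThan)
  have zero: "A $$ (i,k) * B $$ (k,j) = 0" if "i < n" "k < n" "k < i \<or> j < k" for i j k
    using that A B by (auto simp: upper_triangular_def)
  show "upper_triangular (A * B)"
  proof (rule upper_triangularI)
    fix i j assume "j < i" "i < dim_row (A * B)"
    then show "(A * B) $$ (i,j) = 0"
      using A B by (subst entry) (auto intro!: sum.neutral zero simp del: mult_eq_0_iff)
  qed
  show "(A * B) $$ (i,i) = A $$ (i,i) * B $$ (i,i)" if i: "i < n"
  proof -
    have "(\<Sum>k<n. A $$ (i,k) * B $$ (k,i)) = (\<Sum>k\<in>{i}. A $$ (i,k) * B $$ (k,i))"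
      using i by (intro sum.mono_neutral_right) (auto intro!: zero simp del: mult_eq_0_iff)
    then show ?thesis using entry[OF i i] by simp
  qed
qed

lemma upper_triangular_pow_diag:
  fixes A :: "complex mat"
  assumes A: "A \<in> carrier_mat n n" "upper_triangular A"
  shows "upper_triangular (A ^\<^sub>m k) \<and> (\<forall>i<n. (A ^\<^sub>m k) $$ (i,i) = A $$ (i,i) ^ k)"
proof (induction k)
  case 0
  then show ?case using A by auto
next
  case (Suc k)
  have "A ^\<^sub>m k \<in> carrier_mat n n" using A by simp
  then show ?case using upper_triangular_mult_diag[of "A ^\<^sub>m k" n A] A Suc by auto
qed

lemma pow_mat_Suc_left:
  fixes A :: "complex mat"
  assumes A: "A \<in> carrier_mat n n"
  shows "A ^\<^sub>m Suc k = A * A ^\<^sub>m k"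
proof (induction k)
  case 0
  then show ?case using A by simp
next
  case (Suc k)
  have c: "A ^\<^sub>m k \<in> carrier_mat n n" using A by simp
  have "A ^\<^sub>m Suc (Suc k) = A ^\<^sub>m Suc k * A" by (rule pow_mat.simps)
  also have "\<dots> = A * A ^\<^sub>m k * A" by (simp only: Suc)
  also have "\<dots> = A * (A ^\<^sub>m k * A)" by (rule assoc_mult_mat[OF A c A])
  finally show ?case by simp
qed

text \<open>The sum \<open>S\<close> of the powers \<open>B\<^sup>j\<close> with \<open>j < k\<close> satisfies \<open>B S = S\<close>, and it is invertible because it is
triangular with all diagonal entries equal to \<open>k\<close>.\<close>

lemma unitriangular_finite_order:
  fixes B :: "complex mat"
  assumes B: "B \<in> carrier_mat n n" "upper_triangular B" and d: "\<And>i. i < n \<Longrightarrow> B $$ (i,i) = 1"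
    and k: "k > 0" "B ^\<^sub>m k = 1\<^sub>m n"
  shows "B = 1\<^sub>m n"
proof -
  define S where "S = mat n n (\<lambda>(a,b). \<Sum>j<k. (B ^\<^sub>m j) $$ (a,b))"
  have S: "S \<in> carrier_mat n n" by (simp add: S_def)
  note pw = upper_triangular_pow_diag[OF B]
  have "upper_triangular S"
  proof (rule upper_triangularI)
    fix i j assume "j < i" "i < dim_row S"
    moreover have "(B ^\<^sub>m l) $$ (i,j) = 0" if "j < i" "i < n" for l
    proof -
      have "dim_row (B ^\<^sub>m l) = n" using B by simp
      then show ?thesis using pw[of l] that upper_triangularD by metis
    qed
    ultimately show "S $$ (i,j) = 0" by (simp add: S_def)
  qed
  moreover have "S $$ (i,i) = of_nat k" if "i < n" for i
    using that pw d by (simp add: S_def)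
  then have "0 \<notin> set (diag_mat S)" using k S by (auto simp: diag_mat_def)
  ultimately have "det S \<noteq> 0" using upper_triangular_imp_det_eq_0_iff[OF S] by blast
  then have "S \<in> Units (ring_mat TYPE(complex) n ())" by (rule det_non_zero_imp_unit[OF S])
  then obtain S' where S': "S' \<in> carrier_mat n n" "S * S' = 1\<^sub>m n"
    unfolding Units_def ring_mat_def by auto
  have "B * S = S"
  proof (rule eq_matI)
    fix a b assume "a < dim_row S" "b < dim_col S"
    then have ab: "a < n" "b < n" using S by auto
    have "(B * S) $$ (a,b) = (\<Sum>c<n. B $$ (a,c) * (\<Sum>j<k. (B ^\<^sub>m j) $$ (c,b)))"
      using ab B S by (auto simp: scalar_prod_def atLeast0LessThan S_def)
    also have "\<dots> = (\<Sum>j<k. \<Sum>c<n. B $$ (a,c) * (B ^\<^sub>m j) $$ (c,b))"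
      by (subst sum.swap) (simp add: sum_distrib_left)
    also have "\<dots> = (\<Sum>j<k. (B ^\<^sub>m Suc j) $$ (a,b))"
    proof (rule sum.cong[OF refl])
      fix j
      have c: "B ^\<^sub>m j \<in> carrier_mat n n" using B by simp
      have "B ^\<^sub>m Suc j = B * B ^\<^sub>m j" by (rule pow_mat_Suc_left[OF B(1)])
      then show "(\<Sum>c<n. B $$ (a,c) * (B ^\<^sub>m j) $$ (c,b)) = (B ^\<^sub>m Suc j) $$ (a,b)"
        using ab B c by (auto simp: scalar_prod_def atLeast0LessThan)
    qed
    also have "\<dots> = S $$ (a,b) + ((B ^\<^sub>m k) $$ (a,b) - (B ^\<^sub>m 0) $$ (a,b))"
      using ab unfolding sum_lessThan_telescope[of "\<lambda>j. (B ^\<^sub>m j) $$ (a,b)" k, symmetric] S_def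
      by (simp add: sum_subtractf del: pow_mat.simps)
    also have "\<dots> = S $$ (a,b)" using k B by simp
    finally show "(B * S) $$ (a,b) = S $$ (a,b)" .
  qed (use B S in auto)
  then have "B * S * S' = S * S'" by simp
  then show ?thesis using B S S' by simp
qed

text \<open>The numbers \<open>d i\<close> are the eigenvalues, read off from a Schur triangularization. If the \<open>n\<close> roots of
unity \<open>d i\<close> add up to \<open>n\<close>, all of them are \<open>1\<close>, and the triangular form is unitriangular.\<close>

lemma finite_order_mat:
  fixes A :: "complex mat"
  assumes A: "A \<in> carrier_mat n n" and k: "k > 0" "A ^\<^sub>m k = 1\<^sub>m n"
  obtains d :: "nat \<Rightarrow> complex" where "\<And>i. i < n \<Longrightarrow> d i ^ k = 1"
    and "mat_trace A = (\<Sum>i<n. d i)" and "mat_trace A = of_nat n \<Longrightarrow> A = 1\<^sub>m n"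
proof -
  obtain es where es: "char_poly A = (\<Prod>a\<leftarrow>es. [:- a, 1:])" using char_poly_factorized[OF A] by blast
  obtain B P Q where s: "schur_decomposition A es = (B, P, Q)" by (cases "schur_decomposition A es")
  have sim: "similar_mat_wit A B P Q" and ut: "upper_triangular B"
    using schur_decomposition[OF A es s] by auto
  note w = similar_mat_witD2[OF A sim]
  define d where "d = (\<lambda>i. B $$ (i,i))"
  have Bk: "B ^\<^sub>m k = 1\<^sub>m n"
  proof -
    have "B ^\<^sub>m k = Q * A ^\<^sub>m k * P"
      using similar_mat_wit_pow_id[OF similar_mat_wit_sym[OF sim]] .
    then show ?thesis using k w by simp
  qed
  have d1: "d i ^ k = 1" if "i < n" for i
    using upper_triangular_pow_diag[OF w(5) ut, of k] that Bk by (simp add: d_def)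
  have "mat_trace A = mat_trace B" unfolding w(3)
    by (rule mat_trace_conj) (use w in auto)
  then have tr: "mat_trace A = (\<Sum>i<n. d i)" using w by (simp add: mat_trace_def d_def)
  have "A = 1\<^sub>m n" if n: "mat_trace A = of_nat n"
  proof -
    have nd: "norm (d i) = 1" if "i < n" for i
    proof -
      have "norm (d i) ^ k = 1 ^ k" using d1[OF that] by (simp flip: norm_power)
      then show ?thesis using k(1) by (subst (asm) power_eq_iff_eq_base) auto
    qed
    have "(\<Sum>i<n. 1 - Re (d i)) = 0"
      using n tr by (simp add: sum_subtractf flip: Re_sum)
    moreover have "1 - Re (d i) \<ge> 0" if "i < n" for i
      using nd[OF that] complex_Re_le_cmod[of "d i"] by simp
    ultimately have "Re (d i) = 1" if "i < n" for i
      using that by (subst (asm) sum_nonneg_eq_0_iff) auto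
    then have "d i = 1" if "i < n" for i
      using that nd[OF that] cmod_power2[of "d i"] by (simp add: complex_eq_iff)
    then have "B $$ (i,i) = 1" if "i < n" for i
      using that by (simp add: d_def)
    then have "B = 1\<^sub>m n" using unitriangular_finite_order[OF w(5) ut _ k(1) Bk] by blast
    then show ?thesis using w by simp
  qed
  with d1 tr show ?thesis using that by blast
qed

text \<open>The first \<open>k\<close> columns of \<open>Q\<close> form a basis of \<open>W\<close> and all columns a basis of the whole space, so
conjugation with \<open>Q\<close> makes every matrix that preserves \<open>W\<close> block triangular.\<close>

lemma adapted_basis:
  assumes W: "VectorSpace.subspace class_ring W (module_vec TYPE(complex) n)"
    and W0: "W \<noteq> {0\<^sub>v n}" and W1: "W \<noteq> carrier_vec n"
  obtains Q Q' :: "complex mat" and k where "Q \<in> carrier_mat n n" "Q' \<in> carrier_mat n n"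
    "Q * Q' = 1\<^sub>m n" "Q' * Q = 1\<^sub>m n" "0 < k" "k < n" "\<And>j. j < k \<Longrightarrow> col Q j \<in> W"
    "\<And>u i. u \<in> carrier_vec n \<Longrightarrow> Q *\<^sub>v u \<in> W \<Longrightarrow> k \<le> i \<Longrightarrow> i < n \<Longrightarrow> u $ i = 0"
proof -
  interpret vec_space "TYPE(complex)" n .
  have sm: "LinearCombinations.submodule class_ring W V" using W by (simp add: VectorSpace.subspace_def)
  then have WV: "W \<subseteq> carrier_vec n" by (simp add: submodule_def)
  have li0: "lin_indpt {}" by (simp add: lin_dep_def)
  have b: "finite S \<and> card S \<le> n" if "S \<subseteq> carrier_vec n" "lin_indpt S" for S
    using li_le_dim[OF fin_dim, of S] that dim_is_n by auto
  obtain A where A: "finite A" "maximal A (\<lambda>S. S \<subseteq> W \<and> lin_indpt S)"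
    using maximal_exists[of "\<lambda>S. S \<subseteq> W \<and> lin_indpt S" n "{}"] b li0 WV by blast
  have AW: "A \<subseteq> W" and liA: "lin_indpt A" using A(2) by (auto simp: maximal_def)
  have AV: "A \<subseteq> carrier_vec n" using AW WV by blast
  \<comment> \<open>\<open>A\<close> is a basis of \<open>W\<close>, and \<open>B\<close> extends it to a basis of the whole space.\<close>
  obtain B where B: "finite B" "maximal B (\<lambda>S. A \<subseteq> S \<and> S \<subseteq> carrier_vec n \<and> lin_indpt S)"
    using maximal_exists[of "\<lambda>S. A \<subseteq> S \<and> S \<subseteq> carrier_vec n \<and> lin_indpt S" n A] b liA AV by blast
  have AB: "A \<subseteq> B" and BV: "B \<subseteq> carrier_vec n" and liB: "lin_indpt B" using B(2) by (auto simp: maximal_def)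
  have "S = B" if "B \<subseteq> S" "S \<subseteq> carrier_vec n" "lin_indpt S" for S
    using B(2) AB that unfolding maximal_def by (meson subset_trans)
  then have "maximal B (\<lambda>S. S \<subseteq> carrier_vec n \<and> lin_indpt S)"
    unfolding maximal_def using BV liB by meson
  then have basB: "basis B" using max_li_is_basis by simp
  then have cardB: "card B = n" using dim_basis[OF B(1)] dim_is_n by simp
  have spB: "span B = carrier_vec n" using basB by (simp add: basis_def)
  have spA: "span A = W"
  proof
    show "span A \<subseteq> W" using span_is_subset[OF AW sm] .
    show "W \<subseteq> span A"
    proof
      fix w assume w: "w \<in> W"
      show "w \<in> span A"
      proof (rule ccontr)
        assume n: "w \<notin> span A"
        then have "w \<notin> A" using in_own_span AV by auto
        then have "lin_indpt (A \<union> {w})" using lin_dep_iff_in_span[of A w] AV liA w WV n by auto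
        then have "A \<union> {w} = A" using A(2) AW w unfolding maximal_def by blast
        then show False using \<open>w \<notin> A\<close> by auto
      qed
    qed
  qed
  obtain as where as: "set as = A" "distinct as" using finite_distinct_list[OF A(1)] by blast
  obtain bs where bs: "set bs = B - A" "distinct bs" using finite_distinct_list[of "B - A"] B(1) by blast
  define vs where "vs = as @ bs"
  have vs: "set vs = B" using as bs AB by (auto simp: vs_def)
  have "distinct vs" using as bs by (auto simp: vs_def)
  then have len: "length vs = n" using vs cardB distinct_card by metis
  define Q where "Q = mat_of_cols n vs"
  have Q: "Q \<in> carrier_mat n n" using mat_of_cols_carrier(1)[of n vs] len by (simp only: Q_def)
  have colQ: "col Q j = vs ! j" if "j < n" for j
    using that len vs BV nth_mem unfolding Q_def by (intro col_mat_of_cols) (auto simp: subset_iff)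
  have dimvs: "\<forall>w\<in>set vs. dim_vec w = n" using vs BV by auto
  have "\<exists>u\<in>carrier_vec n. Q *\<^sub>v u = v" if v: "v \<in> carrier_vec n" for v
  proof -
    have "v \<in> span_list vs" using v spB vs BV span_list_as_span[of vs] by simp
    then obtain c where "v = lincomb_list c vs" by (auto simp: span_list_def)
    also have "\<dots> = Q *\<^sub>v vec n c" unfolding Q_def
      using lincomb_list_as_mat_mult[OF dimvs, of c] len by (simp only:)
    finally show ?thesis by (intro bexI[of _ "vec n c"]) auto
  qed
  then obtain f where f: "\<And>v. v \<in> carrier_vec n \<Longrightarrow> f v \<in> carrier_vec n \<and> Q *\<^sub>v f v = v" by metis
  define Q' where "Q' = mat n n (\<lambda>(i,j). f (unit_vec n j) $ i)"
  have Q': "Q' \<in> carrier_mat n n" by (simp add: Q'_def)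
  have QQ': "Q * Q' = 1\<^sub>m n"
  proof (rule eq_matI)
    fix i j assume "i < dim_row (1\<^sub>m n)" "j < dim_col (1\<^sub>m n :: complex mat)"
    then have ij: "i < n" "j < n" by auto
    have "col Q' j = f (unit_vec n j)" using f[of "unit_vec n j"] ij by (intro eq_vecI) (auto simp: Q'_def)
    then have "(Q * Q') $$ (i,j) = (Q *\<^sub>v f (unit_vec n j)) $ i" using ij Q Q' by simp
    also have "\<dots> = 1\<^sub>m n $$ (i,j)" using f[of "unit_vec n j"] ij by simp
    finally show "(Q * Q') $$ (i,j) = 1\<^sub>m n $$ (i,j)" .
  qed (use Q Q' in auto)
  have Q'Q: "Q' * Q = 1\<^sub>m n" using mat_mult_left_right_inverse[OF Q Q' QQ'] .
  define k where "k = length as"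
  have kc: "k = card A" using as distinct_card by (metis k_def)
  have k0: "0 < k" using spA W0 span_empty kc A(1) by (cases "A = {}") (auto simp: card_gt_0_iff)
  have "k \<le> n" using len by (simp add: k_def vs_def)
  moreover have "k \<noteq> n" using kc cardB AB B(1) spA spB W1 card_subset_eq by metis
  ultimately have kn: "k < n" by simp
  have c1: "col Q j \<in> W" if "j < k" for j
    using that kn colQ[of j] AW as by (auto simp: vs_def k_def nth_append)
  have c2: "u $ i = 0" if u: "u \<in> carrier_vec n" and m: "Q *\<^sub>v u \<in> W" and i: "k \<le> i" "i < n" for u i
  proof -
    have "Q *\<^sub>v u \<in> span_list as" using m spA as AV span_list_as_span[of as] by simp
    then obtain c where c: "Q *\<^sub>v u = lincomb_list c as" by (auto simp: span_list_def)
    define c' where "c' = (\<lambda>i. if i < k then c i else 0)"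
    have "\<forall>w\<in>set as. dim_vec w = n" using as AV by auto
    from lincomb_list_as_mat_mult[OF this, of c]
    have "lincomb_list c as = mat_of_cols n as *\<^sub>v vec k c" by (simp only: k_def)
    also have "\<dots> = Q *\<^sub>v vec n c'"
    proof (rule eq_vecI)
      fix i assume "i < dim_vec (Q *\<^sub>v vec n c')"
      then have i: "i < n" using Q by simp
      have "(Q *\<^sub>v vec n c') $ i = (\<Sum>j<n. vs ! j $ i * c' j)"
        using i len by (auto simp: Q_def scalar_prod_def atLeast0LessThan mat_of_cols_index intro!: sum.cong)
      also have "\<dots> = (\<Sum>j<k. vs ! j $ i * c' j)"
        using kn by (intro sum.mono_neutral_right) (auto simp: c'_def)
      also have "\<dots> = (\<Sum>j<k. as ! j $ i * c j)"
        by (intro sum.cong) (auto simp: c'_def vs_def nth_append k_def)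
      also have "\<dots> = (mat_of_cols n as *\<^sub>v vec k c) $ i"
        using i by (auto simp: scalar_prod_def atLeast0LessThan mat_of_cols_index k_def intro!: sum.cong)
      finally show "(mat_of_cols n as *\<^sub>v vec k c) $ i = (Q *\<^sub>v vec n c') $ i" by simp
    qed (simp add: Q_def)
    finally have "Q' *\<^sub>v (Q *\<^sub>v u) = Q' *\<^sub>v (Q *\<^sub>v vec n c')" using c by simp
    then have "u = vec n c'"
      using Q Q' u Q'Q by (simp add: assoc_mult_mat_vec[symmetric, of _ n n _ n])
    then show ?thesis using i by (simp add: c'_def)
  qed
  show ?thesis using that[OF Q Q' QQ' Q'Q k0 kn c1 c2] .
qed

section \<open>Representations and Schur's lemma\<close>

lemma (in group) representationD:
  assumes "representation G n \<rho>"
  shows "g \<in> carrier G \<Longrightarrow> \<rho> g \<in> carrier_mat n n"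
    and "g \<in> carrier G \<Longrightarrow> h \<in> carrier G \<Longrightarrow> \<rho> (g \<otimes> h) = \<rho> g * \<rho> h"
    and "\<rho> \<one> = 1\<^sub>m n"
proof -
  let ?M = "ring_mat TYPE(complex) n ()"
  have \<rho>: "\<rho> \<in> hom G (units_of ?M)"
    using assms by (simp add: representation_def)
  show "g \<in> carrier G \<Longrightarrow> \<rho> g \<in> carrier_mat n n"
    using hom_in_carrier[OF \<rho>, of g] by (simp add: units_of_def Units_def ring_mat_def)
  show "g \<in> carrier G \<Longrightarrow> h \<in> carrier G \<Longrightarrow> \<rho> (g \<otimes> h) = \<rho> g * \<rho> h"
    using hom_mult[OF \<rho>, of g h] by (simp add: units_of_def ring_mat_def)
  have "group (units_of ?M)"
    by (intro monoid.units_group ring.is_monoid ring_mat)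
  then have "group_hom G (units_of ?M) \<rho>"
    using \<rho> by (simp add: group_hom_def group_hom_axioms_def is_group)
  then show "\<rho> \<one> = 1\<^sub>m n"
    using group_hom.hom_one by (fastforce simp: units_of_def ring_mat_def)
qed

lemma (in group) representationI:
  assumes c: "\<And>g. g \<in> carrier G \<Longrightarrow> \<rho> g \<in> carrier_mat n n"
    and m: "\<And>g h. g \<in> carrier G \<Longrightarrow> h \<in> carrier G \<Longrightarrow> \<rho> (g \<otimes> h) = \<rho> g * \<rho> h"
    and one: "\<rho> \<one> = 1\<^sub>m n"
  shows "representation G n \<rho>"
proof -
  have "\<rho> g \<in> Units (ring_mat TYPE(complex) n ())" if g: "g \<in> carrier G" for g
  proof -
    have "\<rho> g * \<rho> (inv g) = 1\<^sub>m n" "\<rho> (inv g) * \<rho> g = 1\<^sub>m n"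
      using m[of g "inv g"] m[of "inv g" g] g one by auto
    then show ?thesis using c[OF g] c[of "inv g"] g by (auto simp: Units_def ring_mat_def)
  qed
  then show ?thesis using m by (auto simp: representation_def hom_def units_of_def ring_mat_def)
qed

lemma (in group) representation_inv:
  assumes r: "representation G n \<rho>" and g: "g \<in> carrier G"
  shows "\<rho> (inv g) * \<rho> g = 1\<^sub>m n" "\<rho> g * \<rho> (inv g) = 1\<^sub>m n"
  using representationD(2)[OF r, of g "inv g"] representationD(2)[OF r, of "inv g" g] representationD(3)[OF r] g by auto

lemma (in group) representation_pow:
  assumes r: "representation G n \<rho>" and g: "g \<in> carrier G"
  shows "\<rho> (g [^] (k::nat)) = \<rho> g ^\<^sub>m k"
  using g representationD[OF r] by (induction k) (auto simp: carrier_matD(1)[OF representationD(1)[OF r g]])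

lemma (in group) representation_restrict:
  assumes r: "representation G n \<rho>" and H: "subgroup H G"
  shows "representation (G\<lparr>carrier := H\<rparr>) n \<rho>"
proof -
  interpret H: group "G\<lparr>carrier := H\<rparr>" using H by (rule subgroup_imp_group)
  have "H \<subseteq> carrier G" using H subgroup.subset by blast
  then show ?thesis using representationD[OF r] by (intro H.representationI) (simp_all add: subset_iff)
qed

text \<open>This identifies the kernel of a character, which is defined by its values, with the kernel of the
representation, which is visibly a normal subgroup.\<close>

lemma (in group) representation_trace_kernel:
  assumes fin: "finite (carrier G)" and r: "representation G n \<rho>" and g: "g \<in> carrier G"
    and t: "mat_trace (\<rho> g) = of_nat n"
  shows "\<rho> g = 1\<^sub>m n"
proof -
  have "\<rho> g ^\<^sub>m Coset.order G = 1\<^sub>m n"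
    using representation_pow[OF r g, of "Coset.order G"] pow_order_eq_1[OF g] representationD(3)[OF r] by simp
  moreover have "Coset.order G > 0" using fin order_gt_0_iff_finite by blast
  ultimately show ?thesis
    using finite_order_mat[OF representationD(1)[OF r g], of "Coset.order G"] t by metis
qed

lemma subspace_complex_vec_iff:
  "VectorSpace.subspace class_ring W (module_vec TYPE(complex) n) \<longleftrightarrow>
    W \<subseteq> carrier_vec n \<and> 0\<^sub>v n \<in> W \<and> (\<forall>v\<in>W. \<forall>w\<in>W. v + w \<in> W) \<and> (\<forall>c. \<forall>v\<in>W. c \<cdot>\<^sub>v v \<in> W)"
  using vec_vs[where 'a=complex, of n] vec_module[where 'a=complex, of n]
  by (auto simp: VectorSpace.subspace_def submodule_def module_vec_simps class_ring_simps)

lemma irreducible_subspace_cases: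
  assumes irr: "irreducible_representation G n \<rho>"
    and W: "W \<subseteq> carrier_vec n" "0\<^sub>v n \<in> W" "\<And>v w. v \<in> W \<Longrightarrow> w \<in> W \<Longrightarrow> v + w \<in> W"
      "\<And>c v. v \<in> W \<Longrightarrow> c \<cdot>\<^sub>v v \<in> W"
    and inv: "\<And>g w. g \<in> carrier G \<Longrightarrow> w \<in> W \<Longrightarrow> \<rho> g *\<^sub>v w \<in> W"
  shows "W = {0\<^sub>v n} \<or> W = carrier_vec n"
proof -
  have "VectorSpace.subspace class_ring W (module_vec TYPE(complex) n)"
    unfolding subspace_complex_vec_iff using W by blast
  then show ?thesis using irr inv unfolding irreducible_representation_def by blast
qed

text \<open>An eigenspace of \<open>A\<close> is invariant, hence the whole space.\<close>

lemma (in group) schur_scalar: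
  assumes irr: "irreducible_representation G n \<rho>" and A: "A \<in> carrier_mat n n"
    and comm: "\<And>g. g \<in> carrier G \<Longrightarrow> A * \<rho> g = \<rho> g * A"
  obtains c where "A = c \<cdot>\<^sub>m 1\<^sub>m n"
proof -
  have n: "n > 0" and r: "representation G n \<rho>" using irr by (auto simp: irreducible_representation_def)
  obtain c where "c \<in> spectrum A" using spectrum_non_empty[OF A n] by blast
  then obtain v where v: "v \<in> carrier_vec n" "v \<noteq> 0\<^sub>v n" "A *\<^sub>v v = c \<cdot>\<^sub>v v"
    using A by (auto simp: spectrum_def eigenvalue_def eigenvector_def)
  define W where "W = {w \<in> carrier_vec n. A *\<^sub>v w = c \<cdot>\<^sub>v w}"
  have "W = {0\<^sub>v n} \<or> W = carrier_vec n"
  proof (rule irreducible_subspace_cases[OF irr])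
    show "\<rho> g *\<^sub>v w \<in> W" if g: "g \<in> carrier G" and w: "w \<in> W" for g w
    proof -
      note rg = representationD(1)[OF r g]
      have "A *\<^sub>v (\<rho> g *\<^sub>v w) = \<rho> g *\<^sub>v (A *\<^sub>v w)"
        using A rg w comm[OF g] assoc_mult_mat_vec[OF A rg, of w] assoc_mult_mat_vec[OF rg A, of w] by (auto simp: W_def)
      then show ?thesis using w rg by (simp add: W_def mult_mat_vec[OF rg])
    qed
  qed (use A in \<open>auto simp: W_def mult_add_distrib_mat_vec[OF A] smult_add_distrib_vec[of _ n] mult_mat_vec[OF A] smult_smult_assoc mult.commute\<close>)
  moreover have "v \<in> W" using v by (simp add: W_def)
  ultimately have W: "W = carrier_vec n" using v(2) by auto
  have "A = c \<cdot>\<^sub>m 1\<^sub>m n"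
  proof (rule eq_matI)
    fix i j assume "i < dim_row (c \<cdot>\<^sub>m 1\<^sub>m n)" "j < dim_col (c \<cdot>\<^sub>m 1\<^sub>m n)"
    then have ij: "i < n" "j < n" by auto
    have "unit_vec n j \<in> W" unfolding W using ij by simp
    then have "(A *\<^sub>v unit_vec n j) $ i = (c \<cdot>\<^sub>v unit_vec n j) $ i" by (simp add: W_def)
    moreover have "(A *\<^sub>v unit_vec n j) $ i = A $$ (i,j)" using A ij by simp
    ultimately show "A $$ (i,j) = (c \<cdot>\<^sub>m 1\<^sub>m n) $$ (i,j)" using A ij by simp
  qed (use A in auto)
  then show ?thesis using that by blast
qed

text \<open>All \<open>\<rho> g\<close> are scalar by Schur's lemma, so the line spanned by the first unit vector is invariant.\<close>

lemma (in group) irreducible_abelian_degree: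
  assumes irr: "irreducible_representation G n \<rho>"
    and comm: "\<And>g h. g \<in> carrier G \<Longrightarrow> h \<in> carrier G \<Longrightarrow> \<rho> g * \<rho> h = \<rho> h * \<rho> g"
  shows "n = 1"
proof -
  have n: "n > 0" and r: "representation G n \<rho>" using irr by (auto simp: irreducible_representation_def)
  define W where "W = {w \<in> carrier_vec n. \<forall>i. 0 < i \<and> i < n \<longrightarrow> w $ i = (0::complex)}"
  have "W = {0\<^sub>v n} \<or> W = carrier_vec n"
  proof (rule irreducible_subspace_cases[OF irr])
    show "\<rho> g *\<^sub>v w \<in> W" if g: "g \<in> carrier G" and w: "w \<in> W" for g w
    proof -
      obtain c where "\<rho> g = c \<cdot>\<^sub>m 1\<^sub>m n"
        using schur_scalar[OF irr representationD(1)[OF r g]] comm g by blast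
      moreover have "(c \<cdot>\<^sub>m 1\<^sub>m n) *\<^sub>v w = c \<cdot>\<^sub>v w"
        using w by (auto simp: W_def intro!: eq_vecI)
      ultimately show ?thesis using w by (auto simp: W_def)
    qed
  qed (auto simp: W_def)
  moreover have "unit_vec n 0 \<in> W" using n by (auto simp: W_def unit_vec_def)
  moreover have "unit_vec n 0 \<noteq> (0\<^sub>v n :: complex vec)" using n by simp
  ultimately have W: "W = carrier_vec n" by auto
  show ?thesis
  proof (rule ccontr)
    assume "n \<noteq> 1"
    then have "1 < n" using n by simp
    then have "unit_vec n 1 \<in> W" unfolding W by simp
    then show False using \<open>1 < n\<close> by (auto simp: W_def)
  qed
qed

section \<open>Composition factors\<close>

lemma sum_lessThan_plus:
  fixes f :: "nat \<Rightarrow> 'b::comm_monoid_add"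
  shows "(\<Sum>l<k+q. f l) = (\<Sum>l<k. f l) + (\<Sum>l<q. f (k + l))"
  by (induction q) (simp_all add: add.assoc)

lemma (in group) invariant_subspace_blocks:
  assumes r: "representation G n \<rho>"
    and W: "VectorSpace.subspace class_ring W (module_vec TYPE(complex) n)"
    and inv: "\<forall>g\<in>carrier G. \<forall>w\<in>W. \<rho> g *\<^sub>v w \<in> W"
    and W0: "W \<noteq> {0\<^sub>v n}" and W1: "W \<noteq> carrier_vec n"
  shows "\<exists>k q \<sigma> \<tau>. n = k + q \<and> k < n \<and> q < n \<and>
    representation G k \<sigma> \<and> representation G q \<tau> \<and>
    (\<forall>g\<in>carrier G. mat_trace (\<rho> g) = mat_trace (\<sigma> g) + mat_trace (\<tau> g)) \<and>
    (\<forall>g\<in>carrier G. \<rho> g = 1\<^sub>m n \<longrightarrow> \<sigma> g = 1\<^sub>m k \<and> \<tau> g = 1\<^sub>m q)"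
proof -
  obtain Q Q' k where Q: "Q \<in> carrier_mat n n" and Q': "Q' \<in> carrier_mat n n"
    and QQ': "Q * Q' = 1\<^sub>m n" and Q'Q: "Q' * Q = 1\<^sub>m n" and k: "0 < k" "k < n"
    and colW: "\<And>j. j < k \<Longrightarrow> col Q j \<in> W"
    and tail: "\<And>u i. u \<in> carrier_vec n \<Longrightarrow> Q *\<^sub>v u \<in> W \<Longrightarrow> k \<le> i \<Longrightarrow> i < n \<Longrightarrow> u $ i = 0"
    using adapted_basis[OF W W0 W1] by metis
  define q where "q = n - k"
  have n: "n = k + q" using k by (simp add: q_def)
  define A where "A = (\<lambda>g. Q' * \<rho> g * Q)"
  define \<sigma> where "\<sigma> = (\<lambda>g. mat k k (\<lambda>(i,j). A g $$ (i,j)))"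
  define \<tau> where "\<tau> = (\<lambda>g. mat q q (\<lambda>(i,j). A g $$ (k+i,k+j)))"
  note rc = representationD(1)[OF r]
  have Ac: "A g \<in> carrier_mat n n" if "g \<in> carrier G" for g
    using rc[OF that] Q Q' by (simp add: A_def)
  have Am: "A (g \<otimes> h) = A g * A h" if g: "g \<in> carrier G" and h: "h \<in> carrier G" for g h
  proof -
    have c1: "Q' * \<rho> g \<in> carrier_mat n n" "\<rho> h * Q \<in> carrier_mat n n"
      using mult_carrier_mat[OF Q' rc[OF g]] mult_carrier_mat[OF rc[OF h] Q] by auto
    have "A g * A h = (Q' * \<rho> g) * Q * (Q' * (\<rho> h * Q))"
      using rc[OF h] Q Q' by (simp add: A_def assoc_mult_mat[of _ n n _ n _ n])
    also have "\<dots> = (Q' * \<rho> g) * (Q * (Q' * (\<rho> h * Q)))"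
      using c1 Q Q' by (simp add: assoc_mult_mat[of _ n n _ n _ n])
    also have "Q * (Q' * (\<rho> h * Q)) = \<rho> h * Q"
      using Q Q' QQ' left_mult_one_mat[OF c1(2)] assoc_mult_mat[OF Q Q' c1(2)] by simp
    also have "(Q' * \<rho> g) * (\<rho> h * Q) = A (g \<otimes> h)"
      using rc[OF h] rc[OF g] Q Q' representationD(2)[OF r g h] by (simp add: A_def assoc_mult_mat[of _ n n _ n _ n])
    finally show ?thesis by simp
  qed
  have Aone: "A g = 1\<^sub>m n" if "\<rho> g = 1\<^sub>m n" for g
    using that Q Q' Q'Q by (simp add: A_def)
  \<comment> \<open>The lower left block vanishes because \<open>W\<close> is invariant.\<close>
  have low: "A g $$ (i,j) = 0" if g: "g \<in> carrier G" and i: "k \<le> i" "i < n" and j: "j < k" for g i j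
  proof -
    have "Q *\<^sub>v col (A g) j = col (Q * A g) j" by (rule col_mult2[OF Q Ac[OF g], symmetric]) (use j k in simp)
    also have "Q * A g = \<rho> g * Q"
    proof -
      have "Q * A g = Q * (Q' * \<rho> g) * Q"
        unfolding A_def by (rule assoc_mult_mat[OF Q mult_carrier_mat[OF Q' rc[OF g]] Q, symmetric])
      also have "Q * (Q' * \<rho> g) = Q * Q' * \<rho> g"
        by (rule assoc_mult_mat[OF Q Q' rc[OF g], symmetric])
      finally show ?thesis using rc[OF g] QQ' by simp
    qed
    also have "col (\<rho> g * Q) j = \<rho> g *\<^sub>v col Q j" by (rule col_mult2[OF rc[OF g] Q]) (use j k in simp)
    finally have "Q *\<^sub>v col (A g) j \<in> W" using inv g colW[OF j] by simp
    then have "col (A g) j $ i = 0" by (rule tail[OF _ _ i, rotated]) (use Ac[OF g] in \<open>auto simp: col_def\<close>)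
    then show ?thesis using Ac[OF g] i j by simp
  qed
  have Ae: "A (g \<otimes> h) $$ (i,j) = (\<Sum>l<k. A g $$ (i,l) * A h $$ (l,j)) + (\<Sum>l<q. A g $$ (i,k+l) * A h $$ (k+l,j))"
    if "g \<in> carrier G" "h \<in> carrier G" "i < n" "j < n" for g h i j
  proof -
    have "A (g \<otimes> h) $$ (i,j) = (\<Sum>l<n. A g $$ (i,l) * A h $$ (l,j))"
      using Am Ac[of g] Ac[of h] that by (auto simp: scalar_prod_def atLeast0LessThan)
    then show ?thesis by (simp only: n sum_lessThan_plus)
  qed
  have "representation G k \<sigma>"
  proof (rule representationI)
    fix g h assume g: "g \<in> carrier G" and h: "h \<in> carrier G"
    show "\<sigma> (g \<otimes> h) = \<sigma> g * \<sigma> h"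
      using k Ae[OF g h] low[OF h] n
      by (intro eq_matI) (auto simp: \<sigma>_def scalar_prod_def atLeast0LessThan)
  qed (use k representationD(3)[OF r] in \<open>auto simp: \<sigma>_def Aone\<close>)
  moreover have "representation G q \<tau>"
  proof (rule representationI)
    fix g h assume g: "g \<in> carrier G" and h: "h \<in> carrier G"
    show "\<tau> (g \<otimes> h) = \<tau> g * \<tau> h"
      using k Ae[OF g h] low[OF g] n
      by (intro eq_matI) (auto simp: \<tau>_def scalar_prod_def atLeast0LessThan)
  qed (use k n representationD(3)[OF r] in \<open>auto simp: \<tau>_def Aone\<close>)
  moreover have "mat_trace (\<rho> g) = mat_trace (\<sigma> g) + mat_trace (\<tau> g)" if g: "g \<in> carrier G" for g
  proof -
    have "mat_trace (\<rho> g) = mat_trace (A g)"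
      unfolding A_def by (rule mat_trace_conj[symmetric]) (use rc[OF g] Q Q' QQ' in auto)
    also have "\<dots> = (\<Sum>i<k+q. A g $$ (i,i))" using Ac[OF g] n by (simp add: mat_trace_def)
    also have "\<dots> = mat_trace (\<sigma> g) + mat_trace (\<tau> g)"
      unfolding sum_lessThan_plus by (simp add: mat_trace_def \<sigma>_def \<tau>_def)
    finally show ?thesis .
  qed
  moreover have "\<sigma> g = 1\<^sub>m k \<and> \<tau> g = 1\<^sub>m q" if "g \<in> carrier G" "\<rho> g = 1\<^sub>m n" for g
    using Aone[OF that(2)] n by (auto simp: \<sigma>_def \<tau>_def)
  moreover have "q < n" using n k by simp
  ultimately show ?thesis using n k(2)
    by (intro exI[of _ k] exI[of _ q] exI[of _ \<sigma>] exI[of _ \<tau>] conjI ballI impI) simp_all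
qed

text \<open>Repeated block triangularization gives an irreducible constituent for every diagonal block. The
statement records what later arguments use: degrees and traces are additive in the blocks, and the
kernel of \<open>\<rho>\<close> is contained in the kernel of every block.\<close>

lemma (in group) composition_factors:
  assumes "representation G n \<rho>"
  shows "\<exists>L :: (nat \<times> ('a \<Rightarrow> complex mat)) list.
    (\<forall>(m,\<sigma>)\<in>set L. irreducible_representation G m \<sigma> \<and>
       (\<forall>g\<in>carrier G. \<rho> g = 1\<^sub>m n \<longrightarrow> \<sigma> g = 1\<^sub>m m)) \<and>
    n = (\<Sum>(m,\<sigma>)\<leftarrow>L. m) \<and>
    (\<forall>g\<in>carrier G. mat_trace (\<rho> g) = (\<Sum>(m,\<sigma>)\<leftarrow>L. mat_trace (\<sigma> g)))"
  using assms
proof (induction n arbitrary: \<rho> rule: less_induct)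
  case (less n)
  note r = less.prems
  consider "n = 0" | "n > 0" "irreducible_representation G n \<rho>" |
    W where "VectorSpace.subspace class_ring W (module_vec TYPE(complex) n)"
      "\<forall>g\<in>carrier G. \<forall>w\<in>W. \<rho> g *\<^sub>v w \<in> W" "W \<noteq> {0\<^sub>v n}" "W \<noteq> carrier_vec n"
    using r unfolding irreducible_representation_def by blast
  then show ?case
  proof cases
    case 1
    have "mat_trace (\<rho> g) = 0" if "g \<in> carrier G" for g
      using representationD(1)[OF r that] 1 by (simp add: mat_trace_def)
    then show ?thesis using 1 by (intro exI[of _ "[]"]) simp
  next
    case 2
    then show ?thesis by (intro exI[of _ "[(n,\<rho>)]"]) simp
  next
    case 3
    obtain k q \<sigma> \<tau> where n: "n = k + q" and lt: "k < n" "q < n"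
      and s: "representation G k \<sigma>" and t: "representation G q \<tau>"
      and tr: "\<forall>g\<in>carrier G. mat_trace (\<rho> g) = mat_trace (\<sigma> g) + mat_trace (\<tau> g)"
      and ker: "\<forall>g\<in>carrier G. \<rho> g = 1\<^sub>m n \<longrightarrow> \<sigma> g = 1\<^sub>m k \<and> \<tau> g = 1\<^sub>m q"
      using invariant_subspace_blocks[OF r 3] by (elim exE conjE) (rule that)
    obtain L where L: "\<forall>(m,\<sigma>')\<in>set L. irreducible_representation G m \<sigma>' \<and>
       (\<forall>g\<in>carrier G. \<sigma> g = 1\<^sub>m k \<longrightarrow> \<sigma>' g = 1\<^sub>m m)" "k = (\<Sum>(m,\<sigma>)\<leftarrow>L. m)"
       "\<forall>g\<in>carrier G. mat_trace (\<sigma> g) = (\<Sum>(m,\<sigma>)\<leftarrow>L. mat_trace (\<sigma> g))"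
      using less.IH[OF lt(1) s] by (elim exE conjE) (rule that)
    obtain M where M: "\<forall>(m,\<sigma>')\<in>set M. irreducible_representation G m \<sigma>' \<and>
       (\<forall>g\<in>carrier G. \<tau> g = 1\<^sub>m q \<longrightarrow> \<sigma>' g = 1\<^sub>m m)" "q = (\<Sum>(m,\<sigma>)\<leftarrow>M. m)"
       "\<forall>g\<in>carrier G. mat_trace (\<tau> g) = (\<Sum>(m,\<sigma>)\<leftarrow>M. mat_trace (\<sigma> g))"
      using less.IH[OF lt(2) t] by (elim exE conjE) (rule that)
    show ?thesis
    proof (intro exI[of _ "L @ M"] conjI)
      show "\<forall>(m,\<sigma>')\<in>set (L @ M). irreducible_representation G m \<sigma>' \<and>
          (\<forall>g\<in>carrier G. \<rho> g = 1\<^sub>m n \<longrightarrow> \<sigma>' g = 1\<^sub>m m)"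
      proof (clarify, intro conjI ballI impI)
        fix m \<sigma>' assume a: "(m, \<sigma>') \<in> set (L @ M)"
        then show "irreducible_representation G m \<sigma>'" using L(1) M(1) by auto
        show "\<sigma>' g = 1\<^sub>m m" if "g \<in> carrier G" "\<rho> g = 1\<^sub>m n" for g
          using a L(1) M(1) ker that by fastforce
      qed
      show "n = (\<Sum>(m,\<sigma>)\<leftarrow>L @ M. m)" using n L(2) M(2) by simp
      show "\<forall>g\<in>carrier G. mat_trace (\<rho> g) = (\<Sum>(m,\<sigma>)\<leftarrow>L @ M. mat_trace (\<sigma> g))"
        using tr L(3) M(3) by simp
    qed
  qed
qed

section \<open>Vectors fixed by a normal subgroup\<close>

text \<open>Since \<open>N\<close> is normal, the vectors fixed by \<open>N\<close> form an invariant subspace.\<close>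

lemma (in group) irreducible_fixed_vector:
  assumes irr: "irreducible_representation G n \<rho>" and N: "N \<lhd> G"
    and v: "v \<in> carrier_vec n" "v \<noteq> 0\<^sub>v n" "\<And>x. x \<in> N \<Longrightarrow> \<rho> x *\<^sub>v v = v"
    and x: "x \<in> N"
  shows "\<rho> x = 1\<^sub>m n"
proof -
  interpret N: normal N G by (rule N)
  have r: "representation G n \<rho>" using irr by (simp add: irreducible_representation_def)
  note rc = representationD(1)[OF r]
  have NG: "y \<in> carrier G" if "y \<in> N" for y using that N.subset by blast
  define W where "W = {w \<in> carrier_vec n. \<forall>x\<in>N. \<rho> x *\<^sub>v w = w}"
  have "W = {0\<^sub>v n} \<or> W = carrier_vec n"
  proof (rule irreducible_subspace_cases[OF irr])
    show "\<rho> g *\<^sub>v w \<in> W" if g: "g \<in> carrier G" and w: "w \<in> W" for g w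
    proof -
      have wc: "w \<in> carrier_vec n" using w by (simp add: W_def)
      have "\<rho> y *\<^sub>v (\<rho> g *\<^sub>v w) = \<rho> g *\<^sub>v w" if y: "y \<in> N" for y
      proof -
        let ?z = "inv g \<otimes> y \<otimes> g"
        have z: "?z \<in> N" using N.inv_op_closed1[OF g y] .
        have "y \<otimes> g = g \<otimes> ?z" using g NG[OF y] by (simp add: m_assoc[symmetric])
        then have "\<rho> y * \<rho> g = \<rho> g * \<rho> ?z"
          using representationD(2)[OF r NG[OF y] g] representationD(2)[OF r g NG[OF z]] by simp
        then have "\<rho> y *\<^sub>v (\<rho> g *\<^sub>v w) = \<rho> g *\<^sub>v (\<rho> ?z *\<^sub>v w)"
          using assoc_mult_mat_vec[OF rc[OF NG[OF y]] rc[OF g] wc] assoc_mult_mat_vec[OF rc[OF g] rc[OF NG[OF z]] wc]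
          by simp
        then show ?thesis using w z by (simp add: W_def)
      qed
      then show ?thesis using wc rc[OF g] by (simp add: W_def)
    qed
    have "\<rho> y *\<^sub>v 0\<^sub>v n = 0\<^sub>v n" if "y \<in> N" for y
      using carrier_matD[OF rc[OF NG[OF that]]] by (intro eq_vecI) (auto simp: scalar_prod_def)
    then show "0\<^sub>v n \<in> W" by (simp add: W_def)
    show "v + w \<in> W" if "v \<in> W" "w \<in> W" for v w
      using that by (auto simp: W_def mult_add_distrib_mat_vec[OF rc[OF NG]])
    show "c \<cdot>\<^sub>v v \<in> W" if "v \<in> W" for c v
      using that by (auto simp: W_def mult_mat_vec[OF rc[OF NG]])
  qed (auto simp: W_def)
  moreover have "v \<in> W" using v by (simp add: W_def)
  ultimately have W: "W = carrier_vec n" using v(2) by auto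
  show ?thesis
  proof (rule eq_matI)
    fix i j assume "i < dim_row (1\<^sub>m n :: complex mat)" "j < dim_col (1\<^sub>m n :: complex mat)"
    then have ij: "i < n" "j < n" by auto
    have "unit_vec n j \<in> W" unfolding W using ij by simp
    then have "(\<rho> x *\<^sub>v unit_vec n j) $ i = unit_vec n j $ i" using x by (simp add: W_def)
    then show "\<rho> x $$ (i,j) = 1\<^sub>m n $$ (i,j)" using rc[OF NG[OF x]] ij by simp
  qed (use rc[OF NG[OF x]] in auto)
qed

text \<open>The matrix \<open>\<Sum>x\<in>N. \<rho> x\<close> is unchanged by multiplication with any \<open>\<rho> x\<close> from the left, so all its
columns are fixed by \<open>N\<close>; its trace is not zero, so neither is one of the columns.\<close>

lemma (in group) trace_sum_fixed_vector:
  assumes r: "representation G n \<rho>" and N: "subgroup N G"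
    and s: "(\<Sum>x\<in>N. mat_trace (\<rho> x)) \<noteq> 0"
  obtains v where "v \<in> carrier_vec n" "v \<noteq> 0\<^sub>v n" "\<And>x. x \<in> N \<Longrightarrow> \<rho> x *\<^sub>v v = v"
proof -
  interpret N: subgroup N G by (rule N)
  note rc = representationD(1)[OF r N.mem_carrier]
  have "(\<Sum>x\<in>N. mat_trace (\<rho> x)) = (\<Sum>x\<in>N. \<Sum>j<n. \<rho> x $$ (j,j))"
    using rc by (auto simp: mat_trace_def intro!: sum.cong)
  also have "\<dots> = (\<Sum>j<n. \<Sum>x\<in>N. \<rho> x $$ (j,j))" by (rule sum.swap)
  finally obtain j where j: "j < n" "(\<Sum>x\<in>N. \<rho> x $$ (j,j)) \<noteq> 0"
    using s by (metis (mono_tags, lifting) lessThan_iff sum.neutral)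
  define v where "v = vec n (\<lambda>i. \<Sum>x\<in>N. \<rho> x $$ (i,j))"
  have "v $ j \<noteq> 0" using j by (simp add: v_def)
  then have "v \<noteq> 0\<^sub>v n" using j by auto
  moreover have "\<rho> x *\<^sub>v v = v" if x: "x \<in> N" for x
  proof (rule eq_vecI)
    fix i assume "i < dim_vec v"
    then have i: "i < n" by (simp add: v_def)
    have "(\<rho> x *\<^sub>v v) $ i = (\<Sum>l<n. \<rho> x $$ (i,l) * (\<Sum>y\<in>N. \<rho> y $$ (l,j)))"
      using rc[OF x] i by (auto simp: v_def scalar_prod_def atLeast0LessThan)
    also have "\<dots> = (\<Sum>y\<in>N. \<Sum>l<n. \<rho> x $$ (i,l) * \<rho> y $$ (l,j))"
      by (subst sum.swap) (simp add: sum_distrib_left)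
    also have "\<dots> = (\<Sum>y\<in>N. \<rho> (x \<otimes> y) $$ (i,j))"
      using rc x i j representationD(2)[OF r]
      by (auto simp: scalar_prod_def atLeast0LessThan carrier_matD[OF rc] intro!: sum.cong)
    also have "\<dots> = (\<Sum>y\<in>N. \<rho> y $$ (i,j))"
      by (rule sum.reindex_bij_witness[where i = "\<lambda>y. inv x \<otimes> y" and j = "\<lambda>y. x \<otimes> y"])
        (use x in \<open>auto simp: m_assoc[symmetric]\<close>)
    finally show "(\<rho> x *\<^sub>v v) $ i = v $ i" using i by (simp add: v_def)
  qed (use rc[OF x] in \<open>auto simp: v_def\<close>)
  ultimately show ?thesis using that[of v] by (simp add: v_def)
qed

lemma (in group) irreducible_normal_trace_sum:
  assumes irr: "irreducible_representation G n \<rho>" and N: "N \<lhd> G"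
    and s: "(\<Sum>x\<in>N. mat_trace (\<rho> x)) \<noteq> 0" and x: "x \<in> N"
  shows "\<rho> x = 1\<^sub>m n"
proof -
  have "representation G n \<rho>" using irr by (simp add: irreducible_representation_def)
  then show ?thesis
    using trace_sum_fixed_vector[OF _ normal_imp_subgroup[OF N] s]
      irreducible_fixed_vector[OF irr N _ _ _ x] by metis
qed

lemma sum_sum_list_swap:
  fixes f :: "'b \<Rightarrow> 'c \<Rightarrow> 'd::comm_monoid_add"
  shows "(\<Sum>x\<in>N. \<Sum>a\<leftarrow>L. f a x) = (\<Sum>a\<leftarrow>L. \<Sum>x\<in>N. f a x)"
  by (induction L) (simp_all add: sum.distrib)

lemma dvd_sum_list:
  fixes p :: nat
  assumes "\<And>a. a \<in> set L \<Longrightarrow> p dvd f a"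
  shows "p dvd (\<Sum>a\<leftarrow>L. f a)"
  using assms by (induction L) auto

text \<open>Each composition factor contributes a natural number to the sum, namely \<open>card N\<close> times its degree or \<open>0\<close>
according as \<open>N\<close> acts trivially on it or not. Some factor has degree prime to \<open>p\<close>, and its contribution
is positive.\<close>

lemma (in group) normal_trace_sum_nonzero:
  assumes fin: "finite (carrier G)" and r: "representation G n \<rho>" and N: "N \<lhd> G"
    and p: "\<not> p dvd n"
    and triv: "\<And>m \<sigma> x. irreducible_representation G m \<sigma> \<Longrightarrow> \<not> p dvd m \<Longrightarrow> x \<in> N \<Longrightarrow> \<sigma> x = 1\<^sub>m m"
  shows "(\<Sum>x\<in>N. mat_trace (\<rho> x)) \<noteq> 0"
proof -
  interpret N: normal N G by (rule N)
  have "finite N" using fin N.subset finite_subset by blast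
  then have cN: "card N > 0" using N.one_closed card_gt_0_iff by blast
  obtain L where irr: "\<forall>(m,\<sigma>)\<in>set L. irreducible_representation G m \<sigma>"
    and n: "n = (\<Sum>(m,\<sigma>)\<leftarrow>L. m)"
    and tr: "\<forall>g\<in>carrier G. mat_trace (\<rho> g) = (\<Sum>(m,\<sigma>)\<leftarrow>L. mat_trace (\<sigma> g))"
    using composition_factors[OF r] by fast
  define c :: "nat \<times> ('a \<Rightarrow> complex mat) \<Rightarrow> nat"
    where "c = (\<lambda>(m,\<sigma>). if \<forall>x\<in>N. \<sigma> x = 1\<^sub>m m then card N * m else 0)"
  have c: "(\<Sum>x\<in>N. mat_trace (\<sigma> x)) = of_nat (c (m,\<sigma>))" if "(m,\<sigma>) \<in> set L" for m \<sigma>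
  proof (cases "\<forall>x\<in>N. \<sigma> x = 1\<^sub>m m")
    case True
    then show ?thesis by (simp add: c_def mat_trace_one)
  next
    case False
    then have "(\<Sum>x\<in>N. mat_trace (\<sigma> x)) = 0"
      using irreducible_normal_trace_sum[OF _ N, of m \<sigma>] irr that by fast
    then show ?thesis using False unfolding c_def by auto
  qed
  have "(\<Sum>x\<in>N. mat_trace (\<rho> x)) = (\<Sum>x\<in>N. \<Sum>a\<leftarrow>L. mat_trace (snd a x))"
    using tr N.mem_carrier by (auto simp: case_prod_unfold intro!: sum.cong)
  also have "\<dots> = (\<Sum>a\<leftarrow>L. \<Sum>x\<in>N. mat_trace (snd a x))" by (rule sum_sum_list_swap)
  also have "\<dots> = (\<Sum>a\<leftarrow>L. of_nat (c a))"
    using c by (intro arg_cong[of _ _ sum_list] map_cong) auto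
  also have "\<dots> = of_nat (\<Sum>a\<leftarrow>L. c a)" by (induction L) auto
  finally have eq: "(\<Sum>x\<in>N. mat_trace (\<rho> x)) = of_nat (\<Sum>a\<leftarrow>L. c a)" .
  obtain m \<sigma> where ms: "(m,\<sigma>) \<in> set L" "\<not> p dvd m"
    using p dvd_sum_list[of L p fst] unfolding n by (force simp: case_prod_unfold)
  have "c (m,\<sigma>) = card N * m" using triv[of m \<sigma>] irr ms by (auto simp: c_def)
  moreover have "m > 0" using ms(2) by (cases m) auto
  ultimately have "c (m,\<sigma>) > 0" using cN by simp
  moreover have "c (m,\<sigma>) \<le> (\<Sum>a\<leftarrow>L. c a)" using ms(1) by (intro member_le_sum_list) auto
  ultimately have "(\<Sum>a\<leftarrow>L. c a) \<noteq> 0" by linarith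
  then show ?thesis unfolding eq by (simp only: of_nat_eq_0_iff not_False_eq_True)
qed

section \<open>Monomial representations and linear characters\<close>

lemma (in group) mult_inv_cancel:
  assumes "x \<in> carrier G" and "y \<in> carrier G"
  shows "x \<otimes> (inv x \<otimes> y) = y" and "inv x \<otimes> (x \<otimes> y) = y"
  using assms by (simp_all add: m_assoc[symmetric])

lemma (in group) left_transversal:
  assumes fin: "finite (carrier G)" and H: "subgroup H G"
  obtains n :: nat and t where "card (carrier G) = n * card H" "\<And>i. i < n \<Longrightarrow> t i \<in> carrier G"
    "\<And>g. g \<in> carrier G \<Longrightarrow> \<exists>!i. i < n \<and> inv (t i) \<otimes> g \<in> H"
proof -
  interpret H: subgroup H G by (rule H)
  define n where "n = card (lcosets H)"
  have "finite (lcosets H)" using fin by (simp add: LCOSETS_def)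
  then obtain f where f: "bij_betw f {0..<n} (lcosets H)"
    using ex_bij_betw_nat_finite n_def by blast
  define t where "t = (\<lambda>i. SOME a. a \<in> carrier G \<and> f i = l_coset G a H)"
  have t: "t i \<in> carrier G \<and> f i = l_coset G (t i) H" if "i < n" for i
  proof -
    have "f i \<in> lcosets H" using bij_betwE[OF f] that by simp
    then have "\<exists>a. a \<in> carrier G \<and> f i = l_coset G a H" by (auto simp: LCOSETS_def)
    then show ?thesis unfolding t_def by (rule someI_ex)
  qed
  have "\<exists>!i. i < n \<and> inv (t i) \<otimes> g \<in> H" if g: "g \<in> carrier G" for g
  proof (rule ex_ex1I)
    have "l_coset G g H \<in> lcosets H" using g by (auto simp: LCOSETS_def)
    then obtain i where i: "i < n" "f i = l_coset G g H" using bij_betw_imp_surj_on[OF f] by (metis atLeastLessThan_iff imageE)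
    then have "g \<in> l_coset G (t i) H" using t[OF i(1)] lcos_self[OF g H] by simp
    then have "inv (t i) \<otimes> g \<in> H" using H.lcos_module_imp[OF is_group] t[OF i(1)] by blast
    then show "\<exists>i. i < n \<and> inv (t i) \<otimes> g \<in> H" using i by blast
  next
    fix i j assume i: "i < n \<and> inv (t i) \<otimes> g \<in> H" and j: "j < n \<and> inv (t j) \<otimes> g \<in> H"
    have "g \<in> f k" if k: "k < n \<and> inv (t k) \<otimes> g \<in> H" for k
    proof -
      have "g = t k \<otimes> (inv (t k) \<otimes> g)" using t[of k] k g by (simp add: m_assoc[symmetric])
      then have "g \<in> l_coset G (t k) H" using k by (auto simp: l_coset_def)
      then show ?thesis using t[of k] k by simp
    qed
    then have "g \<in> f i \<inter> f j" using i j by blast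
    moreover have "f i \<in> lcosets H" "f j \<in> lcosets H" using bij_betwE[OF f] i j by auto
    ultimately have "f i = f j" using lcos_disjoint[OF H] by blast
    then show "i = j" using f i j by (auto simp: bij_betw_def inj_on_def)
  qed
  moreover have "card (carrier G) = n * card H" using l_lagrange[OF fin H] by (simp add: n_def Coset.order_def)
  ultimately show ?thesis using that[of n t] t by blast
qed

text \<open>The representation induced from the linear character \<open>\<theta>\<close> of \<open>H\<close>, with respect to the left transversal
\<open>t 0, \<dots>, t (n - 1)\<close>.\<close>

definition monomial_matrix ::
  "('a, 'b) monoid_scheme \<Rightarrow> 'a set \<Rightarrow> ('a \<Rightarrow> complex) \<Rightarrow> nat \<Rightarrow> (nat \<Rightarrow> 'a) \<Rightarrow> 'a \<Rightarrow> complex mat" where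
  "monomial_matrix G H \<theta> n t g = mat n n (\<lambda>(i,j).
     if inv\<^bsub>G\<^esub> (t i) \<otimes>\<^bsub>G\<^esub> g \<otimes>\<^bsub>G\<^esub> t j \<in> H then \<theta> (inv\<^bsub>G\<^esub> (t i) \<otimes>\<^bsub>G\<^esub> g \<otimes>\<^bsub>G\<^esub> t j) else 0)"

text \<open>In the product of two such matrices at most one term of each entry survives, because \<open>h \<otimes> t j\<close> lies in
exactly one left coset \<open>t m H\<close>.\<close>

lemma (in group) monomial_representation:
  assumes H: "subgroup H G" and one: "\<theta> \<one> = 1"
    and mult: "\<And>h k. h \<in> H \<Longrightarrow> k \<in> H \<Longrightarrow> \<theta> (h \<otimes> k) = \<theta> h * \<theta> k"
    and tG: "\<And>i. i < n \<Longrightarrow> t i \<in> carrier G"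
    and uniq: "\<And>g. g \<in> carrier G \<Longrightarrow> \<exists>!i. i < n \<and> inv (t i) \<otimes> g \<in> H"
  shows "representation G n (monomial_matrix G H \<theta> n t)"
proof (rule representationI)
  interpret H: subgroup H G by (rule H)
  show "monomial_matrix G H \<theta> n t g \<in> carrier_mat n n" for g by (simp add: monomial_matrix_def)
  show "monomial_matrix G H \<theta> n t \<one> = 1\<^sub>m n"
  proof (rule eq_matI)
    fix i j assume "i < dim_row (1\<^sub>m n :: complex mat)" "j < dim_col (1\<^sub>m n :: complex mat)"
    then have ij: "i < n" "j < n" by auto
    have "inv (t i) \<otimes> t j \<in> H \<longleftrightarrow> i = j"
      using uniq[OF tG[OF ij(2)]] ij tG by (metis H.one_closed l_inv)
    then show "monomial_matrix G H \<theta> n t \<one> $$ (i,j) = 1\<^sub>m n $$ (i,j)"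
      using ij tG one by (auto simp: monomial_matrix_def)
  qed (auto simp: monomial_matrix_def)
  fix g h assume g: "g \<in> carrier G" and h: "h \<in> carrier G"
  define l where "l = (\<lambda>y. if y \<in> H then \<theta> y else 0)"
  show "monomial_matrix G H \<theta> n t (g \<otimes> h) = monomial_matrix G H \<theta> n t g * monomial_matrix G H \<theta> n t h"
  proof (rule eq_matI)
    fix i j assume "i < dim_row (monomial_matrix G H \<theta> n t g * monomial_matrix G H \<theta> n t h)"
      "j < dim_col (monomial_matrix G H \<theta> n t g * monomial_matrix G H \<theta> n t h)"
    then have ij: "i < n" "j < n" by (auto simp: monomial_matrix_def)
    note ti = tG[OF ij(1)] and tj = tG[OF ij(2)]
    obtain m where m: "m < n" "inv (t m) \<otimes> (h \<otimes> t j) \<in> H"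
      and mu: "\<And>k. k < n \<Longrightarrow> inv (t k) \<otimes> (h \<otimes> t j) \<in> H \<Longrightarrow> k = m"
      using uniq[of "h \<otimes> t j"] h tj by blast
    note tm = tG[OF m(1)]
    let ?a = "inv (t i) \<otimes> g \<otimes> t m" and ?b = "inv (t m) \<otimes> h \<otimes> t j"
    have bH: "?b \<in> H" using m h tj tm by (simp add: m_assoc)
    have ab: "inv (t i) \<otimes> (g \<otimes> h) \<otimes> t j = ?a \<otimes> ?b"
      using g h ti tj tm by (simp add: m_assoc mult_inv_cancel)
    have aH: "?a \<otimes> ?b \<in> H \<longleftrightarrow> ?a \<in> H"
    proof
      assume "?a \<otimes> ?b \<in> H"
      then have "?a \<otimes> ?b \<otimes> inv ?b \<in> H" using bH by blast
      then show "?a \<in> H" using g h ti tj tm by (simp add: m_assoc)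
    qed (use bH in blast)
    have "(monomial_matrix G H \<theta> n t g * monomial_matrix G H \<theta> n t h) $$ (i,j)
        = (\<Sum>k<n. l (inv (t i) \<otimes> g \<otimes> t k) * l (inv (t k) \<otimes> h \<otimes> t j))"
      using ij by (auto simp: monomial_matrix_def scalar_prod_def atLeast0LessThan l_def intro!: sum.cong)
    also have "\<dots> = (\<Sum>k\<in>{m}. l (inv (t i) \<otimes> g \<otimes> t k) * l (inv (t k) \<otimes> h \<otimes> t j))"
    proof (rule sum.mono_neutral_right)
      show "\<forall>k\<in>{..<n} - {m}. l (inv (t i) \<otimes> g \<otimes> t k) * l (inv (t k) \<otimes> h \<otimes> t j) = 0"
      proof
        fix k assume k: "k \<in> {..<n} - {m}"
        then have "inv (t k) \<otimes> h \<otimes> t j \<notin> H" using mu[of k] h tj tG[of k] by (auto simp: m_assoc)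
        then show "l (inv (t i) \<otimes> g \<otimes> t k) * l (inv (t k) \<otimes> h \<otimes> t j) = 0" by (simp add: l_def)
      qed
    qed (use m in auto)
    also have "\<dots> = l (?a \<otimes> ?b)" using bH aH mult by (simp add: l_def)
    also have "\<dots> = monomial_matrix G H \<theta> n t (g \<otimes> h) $$ (i,j)"
      using ij ab by (simp add: monomial_matrix_def l_def)
    finally show "monomial_matrix G H \<theta> n t (g \<otimes> h) $$ (i,j) =
      (monomial_matrix G H \<theta> n t g * monomial_matrix G H \<theta> n t h) $$ (i,j)" by simp
  qed (auto simp: monomial_matrix_def)
qed

text \<open>The hypothesis \<open>ab\<close> says that \<open>G/D\<close> is abelian. The permutation representation on \<open>G/D\<close> has kernel \<open>D\<close>,
so its composition factors are linear. If all of them took the value \<open>1\<close> at \<open>x\<close>, the trace at \<open>x\<close> would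
be \<open>|G : D|\<close>; but \<open>x\<close>, being outside the normal subgroup \<open>D\<close>, fixes no coset and has trace \<open>0\<close>.\<close>

lemma (in group) linear_character_separates:
  assumes fin: "finite (carrier G)" and D: "D \<lhd> G"
    and ab: "\<And>g h. g \<in> carrier G \<Longrightarrow> h \<in> carrier G \<Longrightarrow> \<exists>d\<in>D. g \<otimes> h = h \<otimes> g \<otimes> d"
    and x: "x \<in> carrier G" "x \<notin> D"
  obtains \<theta> :: "'a \<Rightarrow> complex" where "\<theta> \<one> = 1" "\<theta> x \<noteq> 1"
    "\<And>g h. g \<in> carrier G \<Longrightarrow> h \<in> carrier G \<Longrightarrow> \<theta> (g \<otimes> h) = \<theta> g * \<theta> h"
proof -
  interpret D: normal D G by (rule D)
  have Ds: "subgroup D G" using D normal_imp_subgroup by blast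
  obtain n t where n: "card (carrier G) = n * card D" and tG: "\<And>i. i < n \<Longrightarrow> t i \<in> carrier G"
    and uniq: "\<And>g. g \<in> carrier G \<Longrightarrow> \<exists>!i. i < n \<and> inv (t i) \<otimes> g \<in> D"
    using left_transversal[OF fin Ds] by blast
  define \<rho> where "\<rho> = monomial_matrix G D (\<lambda>_. 1) n t"
  have r: "representation G n \<rho>" unfolding \<rho>_def
    by (rule monomial_representation[OF Ds]) (use tG uniq in auto)
  have "card (carrier G) > 0" using fin by (auto simp: card_gt_0_iff)
  then have n0: "n > 0" using n by (cases n) auto
  have kill: "\<rho> d = 1\<^sub>m n" if d: "d \<in> D" for d
  proof (rule eq_matI)
    fix i j assume "i < dim_row (1\<^sub>m n :: complex mat)" "j < dim_col (1\<^sub>m n :: complex mat)"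
    then have ij: "i < n" "j < n" by auto
    note ti = tG[OF ij(1)] and tj = tG[OF ij(2)] and dG = D.mem_carrier[OF d]
    have c: "inv (t i) \<otimes> d \<otimes> t i \<in> D" using D.inv_op_closed1[OF ti d] .
    have e: "inv (t i) \<otimes> d \<otimes> t j = (inv (t i) \<otimes> d \<otimes> t i) \<otimes> (inv (t i) \<otimes> t j)"
      using ti tj dG by (simp add: m_assoc mult_inv_cancel)
    have "inv (t i) \<otimes> d \<otimes> t j \<in> D \<longleftrightarrow> inv (t i) \<otimes> t j \<in> D"
      unfolding e
    proof
      assume "(inv (t i) \<otimes> d \<otimes> t i) \<otimes> (inv (t i) \<otimes> t j) \<in> D"
      then have "inv (inv (t i) \<otimes> d \<otimes> t i) \<otimes> ((inv (t i) \<otimes> d \<otimes> t i) \<otimes> (inv (t i) \<otimes> t j)) \<in> D"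
        using c by blast
      then show "inv (t i) \<otimes> t j \<in> D"
        using ti tj dG mult_inv_cancel(2)[of "inv (t i) \<otimes> d \<otimes> t i" "inv (t i) \<otimes> t j"] by simp
    qed (use c in blast)
    also have "\<dots> \<longleftrightarrow> i = j" using uniq[OF tj] ij tG by (metis D.one_closed l_inv)
    finally show "\<rho> d $$ (i,j) = 1\<^sub>m n $$ (i,j)" using ij by (simp add: \<rho>_def monomial_matrix_def)
  qed (auto simp: \<rho>_def monomial_matrix_def)
  have tr0: "mat_trace (\<rho> x) = 0"
  proof -
    have "inv (t i) \<otimes> x \<otimes> t i \<notin> D" if i: "i < n" for i
    proof
      assume "inv (t i) \<otimes> x \<otimes> t i \<in> D"
      then have "t i \<otimes> (inv (t i) \<otimes> x \<otimes> t i) \<otimes> inv (t i) \<in> D" using D.inv_op_closed2[OF tG[OF i]] by blast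
      then show False using x tG[OF i] by (simp add: m_assoc mult_inv_cancel)
    qed
    then show ?thesis by (simp add: mat_trace_def \<rho>_def monomial_matrix_def)
  qed
  obtain L where irr: "\<forall>(m,\<sigma>)\<in>set L. irreducible_representation G m \<sigma> \<and>
       (\<forall>g\<in>carrier G. \<rho> g = 1\<^sub>m n \<longrightarrow> \<sigma> g = 1\<^sub>m m)"
    and nL: "n = (\<Sum>(m,\<sigma>)\<leftarrow>L. m)"
    and tr: "\<forall>g\<in>carrier G. mat_trace (\<rho> g) = (\<Sum>(m,\<sigma>)\<leftarrow>L. mat_trace (\<sigma> g))"
    using composition_factors[OF r] by (elim exE conjE) (rule that)
  have lin: "m = 1" if ms: "(m,\<sigma>) \<in> set L" for m \<sigma>
  proof -
    have i: "irreducible_representation G m \<sigma>" and k: "\<And>d. d \<in> D \<Longrightarrow> \<sigma> d = 1\<^sub>m m"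
      using irr ms kill D.mem_carrier by auto
    then have s: "representation G m \<sigma>" by (simp add: irreducible_representation_def)
    show ?thesis
    proof (rule irreducible_abelian_degree[OF i])
      fix g h assume g: "g \<in> carrier G" and h: "h \<in> carrier G"
      then obtain d where d: "d \<in> D" "g \<otimes> h = h \<otimes> g \<otimes> d" using ab by blast
      have "\<sigma> (h \<otimes> g \<otimes> d) = \<sigma> (h \<otimes> g) * \<sigma> d"
        using representationD(2)[OF s, of "h \<otimes> g" d] g h D.mem_carrier[OF d(1)] by simp
      also have "\<dots> = \<sigma> (h \<otimes> g)" using k[OF d(1)] representationD(1)[OF s, of "h \<otimes> g"] g h by simp
      finally show "\<sigma> g * \<sigma> h = \<sigma> h * \<sigma> g"
        using d representationD(2)[OF s] g h by metis
    qed
  qed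
  have "\<exists>(m,\<sigma>)\<in>set L. mat_trace (\<sigma> x) \<noteq> 1"
  proof (rule ccontr)
    assume "\<not> ?thesis"
    then have "(\<Sum>(m,\<sigma>)\<leftarrow>L. mat_trace (\<sigma> x)) = (\<Sum>(m,\<sigma>)\<leftarrow>L. of_nat m)"
      using lin by (intro arg_cong[of _ _ sum_list] map_cong) auto
    also have "\<dots> = of_nat (\<Sum>(m,\<sigma>)\<leftarrow>L. m)" by (induction L) auto
    also have "\<dots> = of_nat n" by (simp only: nL)
    finally show False using tr x(1) tr0 n0 by simp
  qed
  then obtain m \<sigma> where ms: "(m,\<sigma>) \<in> set L" "mat_trace (\<sigma> x) \<noteq> 1" by blast
  then have s: "representation G 1 \<sigma>" using irr lin by (fastforce simp: irreducible_representation_def)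
  show ?thesis
  proof (rule that[of "\<lambda>g. mat_trace (\<sigma> g)"])
    show "mat_trace (\<sigma> \<one>) = 1" using representationD(3)[OF s] by (simp add: mat_trace_one)
    show "mat_trace (\<sigma> x) \<noteq> 1" by (rule ms(2))
    show "mat_trace (\<sigma> (g \<otimes> h)) = mat_trace (\<sigma> g) * mat_trace (\<sigma> h)" if g: "g \<in> carrier G" and h: "h \<in> carrier G" for g h
      using carrier_matD[OF representationD(1)[OF s g]] carrier_matD[OF representationD(1)[OF s h]]
        representationD(2)[OF s g h]
      by (simp add: mat_trace_def scalar_prod_def)
  qed
qed

text \<open>If \<open>\<theta> x \<noteq> 1\<close>, then translation by \<open>x\<close> shows that the sum of \<open>\<theta>\<close> over \<open>K \<inter> H\<close> is \<open>0\<close>. The sum over \<open>K\<close> of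
the character induced from \<open>\<theta>\<close> is a multiple of it, contradicting \<open>normal_trace_sum_nonzero\<close>.\<close>

lemma (in group) linear_character_trivial:
  assumes fin: "finite (carrier G)" and K: "K \<lhd> G"
    and triv: "\<And>m \<sigma> x. irreducible_representation G m \<sigma> \<Longrightarrow> \<not> p dvd m \<Longrightarrow> x \<in> K \<Longrightarrow> \<sigma> x = 1\<^sub>m m"
    and H: "subgroup H G" and index: "card (carrier G) = q * card H" "\<not> p dvd q"
    and one: "\<theta> \<one> = (1::complex)"
    and mult: "\<And>h k. h \<in> H \<Longrightarrow> k \<in> H \<Longrightarrow> \<theta> (h \<otimes> k) = \<theta> h * \<theta> k"
    and x: "x \<in> K" "x \<in> H"
  shows "\<theta> x = 1"
proof (rule ccontr)
  assume ne: "\<theta> x \<noteq> 1"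
  interpret K: normal K G by (rule K)
  interpret H: subgroup H G by (rule H)
  obtain n t where n: "card (carrier G) = n * card H" and tG: "\<And>i. i < n \<Longrightarrow> t i \<in> carrier G"
    and uniq: "\<And>g. g \<in> carrier G \<Longrightarrow> \<exists>!i. i < n \<and> inv (t i) \<otimes> g \<in> H"
    using left_transversal[OF fin H] by blast
  have fH: "finite H" using fin H.subset finite_subset by blast
  then have "card H > 0" using H.one_closed card_gt_0_iff by blast
  then have "n = q" using n index by simp
  have fK: "finite K" using fin K.subset finite_subset by blast
  define \<rho> where "\<rho> = monomial_matrix G H \<theta> n t"
  have r: "representation G n \<rho>" unfolding \<rho>_def
    by (rule monomial_representation[OF H]) (use one mult tG uniq in auto)
  define l where "l = (\<lambda>y. if y \<in> H then \<theta> y else 0)"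
  have "(\<Sum>k\<in>K. l k) = (\<Sum>k\<in>K. l (x \<otimes> k))"
    by (rule sum.reindex_bij_witness[where i = "\<lambda>y. x \<otimes> y" and j = "\<lambda>y. inv x \<otimes> y"])
      (use x in \<open>auto simp: m_assoc[symmetric]\<close>)
  also have "\<dots> = (\<Sum>k\<in>K. \<theta> x * l k)"
  proof (rule sum.cong[OF refl])
    fix k assume k: "k \<in> K"
    have "x \<otimes> k \<in> H \<longleftrightarrow> k \<in> H"
    proof
      assume "x \<otimes> k \<in> H"
      then have "inv x \<otimes> (x \<otimes> k) \<in> H" using x(2) by blast
      then show "k \<in> H" using x k by (simp add: m_assoc[symmetric])
    qed (use x in blast)
    then show "l (x \<otimes> k) = \<theta> x * l k" using mult x by (simp add: l_def)
  qed
  also have "\<dots> = \<theta> x * (\<Sum>k\<in>K. l k)" by (rule sum_distrib_left[symmetric])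
  finally have zero: "(\<Sum>k\<in>K. l k) = 0" using ne by (simp add: algebra_simps) 
  have "(\<Sum>k\<in>K. mat_trace (\<rho> k)) = (\<Sum>k\<in>K. \<Sum>i<n. l (inv (t i) \<otimes> k \<otimes> t i))"
    by (simp add: mat_trace_def \<rho>_def monomial_matrix_def l_def)
  also have "\<dots> = (\<Sum>i<n. \<Sum>k\<in>K. l (inv (t i) \<otimes> k \<otimes> t i))" by (rule sum.swap)
  also have "\<dots> = (\<Sum>i<n. \<Sum>k\<in>K. l k)"
  proof (rule sum.cong[OF refl])
    fix i assume "i \<in> {..<n}"
    then have ti: "t i \<in> carrier G" using tG by simp
    have e: "inv (t i) \<otimes> (t i \<otimes> k \<otimes> inv (t i)) \<otimes> t i = k" "t i \<otimes> (inv (t i) \<otimes> k \<otimes> t i) \<otimes> inv (t i) = k" if "k \<in> K" for k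
      using ti that by (simp_all add: m_assoc mult_inv_cancel)
    show "(\<Sum>k\<in>K. l (inv (t i) \<otimes> k \<otimes> t i)) = (\<Sum>k\<in>K. l k)"
      by (rule sum.reindex_bij_witness[where i = "\<lambda>y. t i \<otimes> y \<otimes> inv (t i)" and j = "\<lambda>y. inv (t i) \<otimes> y \<otimes> t i"])
        (use K.inv_op_closed1[OF ti] K.inv_op_closed2[OF ti] e in auto)
  qed
  finally have "(\<Sum>k\<in>K. mat_trace (\<rho> k)) = 0" using zero by simp
  moreover have "(\<Sum>k\<in>K. mat_trace (\<rho> k)) \<noteq> 0"
    using normal_trace_sum_nonzero[OF fin r K, of p] triv index \<open>n = q\<close> by blast
  ultimately show False by simp
qed

section \<open>The common kernel meets the normalizer inside the derived subgroup\<close>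

lemma (in group) normalizer_mem_iff:
  assumes P: "subgroup P G"
  shows "x \<in> normalizer G P \<longleftrightarrow> x \<in> carrier G \<and> (\<lambda>y. x \<otimes> y \<otimes> inv x) ` P = P"
proof -
  have "P \<subseteq> carrier G" using P subgroup.subset by blast
  have "r_coset G (l_coset G x P) (inv x) = (\<lambda>y. x \<otimes> y \<otimes> inv x) ` P"
    by (auto simp: l_coset_def r_coset_def)
  then show ?thesis using \<open>P \<subseteq> carrier G\<close> by (auto simp: normalizer_def stabilizer_def)
qed

text \<open>Both steps use \<open>linear_character_trivial\<close>: first with \<open>H = P\<langle>x\<rangle>\<close> and a character of \<open>H/P\<close> that is
not \<open>1\<close> at \<open>x\<close>, to see that \<open>x \<in> P\<close>, and then with \<open>H = P\<close> and a character of \<open>P/P'\<close>.\<close>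

lemma (in group) normalizer_inter_le_derived:
  assumes fin: "finite (carrier G)" and K: "K \<lhd> G"
    and triv: "\<And>m \<sigma> x. irreducible_representation G m \<sigma> \<Longrightarrow> \<not> p dvd m \<Longrightarrow> x \<in> K \<Longrightarrow> \<sigma> x = 1\<^sub>m m"
    and P: "subgroup P G" and index: "card (carrier G) = q * card P" "\<not> p dvd q"
  shows "K \<inter> normalizer G P \<subseteq> derived G P"
proof
  fix x assume "x \<in> K \<inter> normalizer G P"
  then have xK: "x \<in> K" and xN: "x \<in> normalizer G P" by auto
  interpret P: subgroup P G by (rule P)
  have Ns: "subgroup (normalizer G P) G" using normalizer_imp_subgroup[OF P.subset] .
  interpret N: subgroup "normalizer G P" G by (rule Ns)
  have xG: "x \<in> carrier G" using xN N.mem_carrier by blast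
  have xP: "x \<in> P"
  proof (rule ccontr)
    assume nP: "x \<notin> P"
    \<comment> \<open>The group generated by \<open>P\<close> and \<open>x\<close>.\<close>
    define H where "H = {x [^] (i::int) \<otimes> z | i z. z \<in> P}"
    have nm: "y \<otimes> z \<otimes> inv y \<in> P" if "y \<in> normalizer G P" "z \<in> P" for y z
      using that normalizer_mem_iff[OF P] by blast
    have nm': "inv y \<otimes> z \<otimes> y \<in> P" if "y \<in> normalizer G P" "z \<in> P" for y z
      using nm[of "inv y" z] that N.m_inv_closed N.mem_carrier by simp
    have pw: "x [^] (i::int) \<in> normalizer G P" for i
      using Ns xN by (rule subgroup_int_pow_closed)
    have PN: "P \<subseteq> normalizer G P"
      using subgroup_in_normalizer[OF P] normal_imp_subgroup subgroup.subset by fastforce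
    have prod: "(x [^] (i::int) \<otimes> z) \<otimes> (x [^] (j::int) \<otimes> w) = x [^] (i+j) \<otimes> ((inv (x [^] j) \<otimes> z \<otimes> x [^] j) \<otimes> w)"
      if "z \<in> P" "w \<in> P" for i j z w
    proof -
      have [simp]: "z \<in> carrier G" "w \<in> carrier G" "x [^] i \<in> carrier G" "x [^] j \<in> carrier G"
        using that xG by auto
      show ?thesis using xG by (simp add: int_pow_mult m_assoc mult_inv_cancel)
    qed
    have HN: "H \<subseteq> normalizer G P" using pw PN unfolding H_def by blast
    have HG: "H \<subseteq> carrier G" using HN N.subset by blast
    have PH: "P \<subseteq> H"
    proof
      fix z assume z: "z \<in> P"
      then have "z = x [^] (0::int) \<otimes> z" by simp
      then show "z \<in> H" using z unfolding H_def by blast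
    qed
    have H: "subgroup H G"
    proof (rule subgroupI[OF HG])
      show "H \<noteq> {}" using PH P.one_closed by blast
      show "a \<otimes> b \<in> H" if ab: "a \<in> H" "b \<in> H" for a b
      proof -
        obtain i z j w where a: "a = x [^] (i::int) \<otimes> z" "z \<in> P" and b: "b = x [^] (j::int) \<otimes> w" "w \<in> P"
          using ab unfolding H_def by blast
        have "(inv (x [^] j) \<otimes> z \<otimes> x [^] j) \<otimes> w \<in> P" using nm'[OF pw a(2)] b(2) by blast
        then show ?thesis using prod[OF a(2) b(2), of i j] a b unfolding H_def by blast
      qed
      show "inv a \<in> H" if aH: "a \<in> H" for a
      proof -
        obtain i z where a: "a = x [^] (i::int) \<otimes> z" "z \<in> P" using aH unfolding H_def by blast
        have zG: "z \<in> carrier G" using a(2) by (rule P.mem_carrier)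
        have "inv a = x [^] (-i) \<otimes> (x [^] i \<otimes> inv z \<otimes> inv (x [^] i))"
          using a xG zG by (simp add: inv_mult_group int_pow_neg m_assoc[symmetric])
        moreover have "x [^] i \<otimes> inv z \<otimes> inv (x [^] i) \<in> P" using nm[OF pw] a by blast
        ultimately show ?thesis unfolding H_def by blast
      qed
    qed
    interpret H: group "G\<lparr>carrier := H\<rparr>" using H by (rule subgroup_imp_group)
    have finH: "finite H" using fin HG finite_subset by blast
    have PnH: "P \<lhd> G\<lparr>carrier := H\<rparr>"
    proof (rule H.normal_invI)
      show "subgroup P (G\<lparr>carrier := H\<rparr>)" using subgroup_incl[OF P H PH] .
      show "y \<otimes>\<^bsub>G\<lparr>carrier := H\<rparr>\<^esub> z \<otimes>\<^bsub>G\<lparr>carrier := H\<rparr>\<^esub> inv\<^bsub>G\<lparr>carrier := H\<rparr>\<^esub> y \<in> P"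
        if "y \<in> carrier (G\<lparr>carrier := H\<rparr>)" "z \<in> P" for y z
        using that nm[of y z] HN m_inv_consistent[OF H] by auto
    qed
    have comm: "\<exists>d\<in>P. a \<otimes>\<^bsub>G\<lparr>carrier := H\<rparr>\<^esub> b = b \<otimes>\<^bsub>G\<lparr>carrier := H\<rparr>\<^esub> a \<otimes>\<^bsub>G\<lparr>carrier := H\<rparr>\<^esub> d"
      if ab: "a \<in> carrier (G\<lparr>carrier := H\<rparr>)" "b \<in> carrier (G\<lparr>carrier := H\<rparr>)" for a b
    proof -
      obtain i z j w where a: "a = x [^] (i::int) \<otimes> z" "z \<in> P" and b: "b = x [^] (j::int) \<otimes> w" "w \<in> P"
        using ab unfolding H_def by auto
      let ?u = "(inv (x [^] j) \<otimes> z \<otimes> x [^] j) \<otimes> w" and ?v = "(inv (x [^] i) \<otimes> w \<otimes> x [^] i) \<otimes> z"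
      have u: "?u \<in> P" and v: "?v \<in> P" using nm'[OF pw] a b by blast+
      have uG: "?u \<in> carrier G" and vG: "?v \<in> carrier G" using P.mem_carrier[OF u] P.mem_carrier[OF v] .
      have ab: "a \<otimes> b = x [^] (i+j) \<otimes> ?u" using prod a b by simp
      have ba: "b \<otimes> a = x [^] (i+j) \<otimes> ?v" using prod[OF b(2) a(2), of j i] a b by (simp add: add.commute)
      have "a \<otimes> b = b \<otimes> a \<otimes> (inv ?v \<otimes> ?u)"
      proof -
        have "x [^] (i+j) \<otimes> ?v \<otimes> (inv ?v \<otimes> ?u) = x [^] (i+j) \<otimes> (?v \<otimes> inv ?v) \<otimes> ?u"
          using uG vG xG by (simp only: m_assoc int_pow_closed inv_closed m_closed)
        also have "\<dots> = x [^] (i+j) \<otimes> ?u" using uG vG xG by (simp only: r_inv int_pow_closed r_one)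
        finally show ?thesis using ab ba by simp
      qed
      moreover have "inv ?v \<otimes> ?u \<in> P" using u v by blast
      ultimately show ?thesis by auto
    qed
    have xH: "x \<in> H"
    proof -
      have "x = x [^] (1::int) \<otimes> \<one>" using xG by simp
      then show ?thesis using P.one_closed unfolding H_def by blast
    qed
    obtain \<theta> :: "'a \<Rightarrow> complex" where l: "\<theta> \<one> = 1" "\<theta> x \<noteq> 1"
      "\<And>g h. g \<in> H \<Longrightarrow> h \<in> H \<Longrightarrow> \<theta> (g \<otimes> h) = \<theta> g * \<theta> h"
      using H.linear_character_separates[OF _ PnH comm, of x] finH xH nP by auto
    obtain a where a: "card H = a * card P"
      using H.lagrange[of P] finH subgroup_incl[OF P H PH] by (auto simp: Coset.order_def) metis
    obtain b where b: "card (carrier G) = b * card H"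
      using lagrange[OF H] by (auto simp: Coset.order_def) metis
    have "card P > 0" using P.one_closed finite_subset[OF P.subset fin] card_gt_0_iff by blast
    then have "q = b * a" using a b index by simp
    then have nb: "\<not> p dvd b" using index by auto
    have "\<theta> x = 1"
      by (rule linear_character_trivial[where p = p, OF fin K _ H b nb]) (use triv l xK xH in blast)+
    then show False using l(2) by simp
  qed
  show "x \<in> derived G P"
  proof (rule ccontr)
    assume nD: "x \<notin> derived G P"
    interpret PG: group "G\<lparr>carrier := P\<rparr>" using P by (rule subgroup_imp_group)
    have Pn: "P \<lhd> G\<lparr>carrier := P\<rparr>"
      by (rule PG.normal_invI) (use PG.subgroup_self m_inv_consistent[OF P] in auto)
    have Dn: "derived G P \<lhd> G\<lparr>carrier := P\<rparr>"
      using PG.derived_is_normal[OF Pn] derived_consistent[OF subset_refl P] by simp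
    have comm: "\<exists>d\<in>derived G P. a \<otimes>\<^bsub>G\<lparr>carrier := P\<rparr>\<^esub> b = b \<otimes>\<^bsub>G\<lparr>carrier := P\<rparr>\<^esub> a \<otimes>\<^bsub>G\<lparr>carrier := P\<rparr>\<^esub> d"
      if abP: "a \<in> carrier (G\<lparr>carrier := P\<rparr>)" "b \<in> carrier (G\<lparr>carrier := P\<rparr>)" for a b
    proof -
      have ab: "a \<in> P" "b \<in> P" using abP by auto
      then have G: "a \<in> carrier G" "b \<in> carrier G" by auto
      let ?d = "inv a \<otimes> inv b \<otimes> inv (inv a) \<otimes> inv (inv b)"
      have "?d \<in> derived_set G P" using ab by blast
      then have "?d \<in> derived G P" unfolding derived_def by (rule generate.incl)
      moreover have "a \<otimes> b = b \<otimes> a \<otimes> ?d"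
        using G by (simp add: m_assoc mult_inv_cancel)
      ultimately show ?thesis by auto
    qed
    have finP: "finite P" using fin P.subset finite_subset by blast
    obtain \<theta> :: "'a \<Rightarrow> complex" where l: "\<theta> \<one> = 1" "\<theta> x \<noteq> 1"
      "\<And>g h. g \<in> P \<Longrightarrow> h \<in> P \<Longrightarrow> \<theta> (g \<otimes> h) = \<theta> g * \<theta> h"
      using PG.linear_character_separates[OF _ Dn comm, of x] finP xP nD by auto
    have "\<theta> x = 1"
      by (rule linear_character_trivial[where p = p, OF fin K _ P index]) (use triv l xK xP in blast)+
    then show False using l(2) by simp
  qed
qed

section \<open>Counting in finite groups\<close>

lemma card_eq_fibre_mult:
  assumes "finite S" and "\<And>y. y \<in> f ` S \<Longrightarrow> card {x \<in> S. f x = y} = c"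
  shows "card S = card (f ` S) * c"
  using sum.image_gen[OF assms(1), of "\<lambda>_. 1::nat" f] assms(2) by simp

lemma (in group) card_set_mult:
  assumes fin: "finite (carrier G)" and U: "subgroup U G" and V: "subgroup V G"
  shows "card (U <#> V) * card (U \<inter> V) = card U * card V"
proof -
  interpret U: subgroup U G by (rule U)
  interpret V: subgroup V G by (rule V)
  have fX: "finite U" and fY: "finite V" using fin U.subset V.subset finite_subset by blast+
  define m where "m = (\<lambda>z. fst z \<otimes> snd z)"
  have im: "m ` (U \<times> V) = U <#> V" by (force simp: set_mult_def m_def)
  have "card {z \<in> U \<times> V. m z = w} = card (U \<inter> V)" if w: "w \<in> m ` (U \<times> V)" for w
  proof -
    obtain a b where ab: "a \<in> U" "b \<in> V" "w = a \<otimes> b" using w by (auto simp: m_def)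
    have G: "a \<in> carrier G" "b \<in> carrier G" using ab by auto
    have "bij_betw (\<lambda>z. (a \<otimes> z, inv z \<otimes> b)) (U \<inter> V) {z \<in> U \<times> V. m z = w}"
    proof (rule bij_betw_byWitness[where f' = "\<lambda>z. inv a \<otimes> fst z"])
      show "\<forall>z\<in>U \<inter> V. inv a \<otimes> fst (a \<otimes> z, inv z \<otimes> b) = z"
        using G by (auto simp: m_assoc[symmetric])
      have *: "inv a \<otimes> x \<in> U \<inter> V \<and> a \<otimes> (inv a \<otimes> x) = x \<and> inv (inv a \<otimes> x) \<otimes> b = y"
        if xy: "x \<in> U" "y \<in> V" "x \<otimes> y = w" for x y
      proof -
        have e: "a \<otimes> b = x \<otimes> y" using xy ab by simp
        have G': "x \<in> carrier G" "y \<in> carrier G" using xy by auto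
        have "inv a \<otimes> x = inv a \<otimes> (x \<otimes> y) \<otimes> inv y" using G G' by (simp add: m_assoc)
        also have "\<dots> = b \<otimes> inv y" using G G' by (simp flip: e add: m_assoc[symmetric])
        finally have 1: "inv a \<otimes> x = b \<otimes> inv y" .
        have "inv (inv a \<otimes> x) \<otimes> b = y" using G G' by (simp add: 1 inv_mult_group m_assoc)
        moreover have "a \<otimes> (inv a \<otimes> x) = x" using G G' by (simp add: m_assoc[symmetric])
        moreover have "inv a \<otimes> x \<in> U" "b \<otimes> inv y \<in> V" using ab xy by auto
        ultimately show ?thesis using 1 by simp
      qed
      show "\<forall>z\<in>{z \<in> U \<times> V. m z = w}. (a \<otimes> (inv a \<otimes> fst z), inv (inv a \<otimes> fst z) \<otimes> b) = z"
        using * by (auto simp: m_def)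
      show "(\<lambda>z. inv a \<otimes> fst z) ` {z \<in> U \<times> V. m z = w} \<subseteq> U \<inter> V"
        using * by (auto simp: m_def)
      show "(\<lambda>z. (a \<otimes> z, inv z \<otimes> b)) ` (U \<inter> V) \<subseteq> {z \<in> U \<times> V. m z = w}"
      proof (intro subsetI, elim imageE)
        fix u z assume z: "z \<in> U \<inter> V" and u: "u = (a \<otimes> z, inv z \<otimes> b)"
        have "a \<otimes> z \<otimes> (inv z \<otimes> b) = a \<otimes> (z \<otimes> inv z) \<otimes> b"
          using G z by (simp only: m_assoc inv_closed m_closed U.mem_carrier IntD1[OF z])
        also have "\<dots> = w" using ab G z by simp
        finally show "u \<in> {z \<in> U \<times> V. m z = w}" using ab z u by (simp add: m_def)
      qed
    qed
    then show ?thesis by (simp add: bij_betw_same_card)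
  qed
  then have "card (U \<times> V) = card (U <#> V) * card (U \<inter> V)"
    using card_eq_fibre_mult[of "U \<times> V" m] fX fY im by simp
  then show ?thesis by (simp add: card_cartesian_product)
qed

lemma (in group) card_subgroup_dvd:
  assumes U: "subgroup U G" and V: "subgroup V G" and "U \<subseteq> V"
  shows "card U dvd card V"
proof -
  interpret V: group "G\<lparr>carrier := V\<rparr>" using V by (rule subgroup_imp_group)
  have "card (rcosets\<^bsub>G\<lparr>carrier := V\<rparr>\<^esub> U) * card U = card V"
    using V.lagrange[OF subgroup_incl[OF U V assms(3)]] by (simp add: Coset.order_def)
  then show ?thesis by (metis dvd_triv_right)
qed

text \<open>The orbits of length greater than \<open>1\<close> have length divisible by \<open>p\<close>. The set \<open>T\<close> represents these
orbits, and \<open>c x\<close> is the length of the orbit of \<open>x\<close> divided by \<open>p\<close>. The quotient by \<open>p\<close> is kept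
explicit so that the identity can be used for counting (\<open>f = 1\<close>) as well as for traces.\<close>

lemma (in group) p_group_action_sum:
  fixes f :: "'e \<Rightarrow> 'c::comm_semiring_1" and a :: "'a \<Rightarrow> 'e \<Rightarrow> 'e"
  assumes p: "Factorial_Ring.prime p" and pG: "card (carrier G) = p ^ k" and finE: "finite E"
    and closed: "\<And>g x. g \<in> carrier G \<Longrightarrow> x \<in> E \<Longrightarrow> a g x \<in> E"
    and one: "\<And>x. x \<in> E \<Longrightarrow> a \<one> x = x"
    and comp: "\<And>g h x. g \<in> carrier G \<Longrightarrow> h \<in> carrier G \<Longrightarrow> x \<in> E \<Longrightarrow> a (g \<otimes> h) x = a g (a h x)"
    and inv: "\<And>g x. g \<in> carrier G \<Longrightarrow> x \<in> E \<Longrightarrow> f (a g x) = f x"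
  obtains T c where "T \<subseteq> E"
    "(\<Sum>x\<in>E. f x) = (\<Sum>x\<in>{x \<in> E. \<forall>g\<in>carrier G. a g x = x}. f x) + of_nat p * (\<Sum>x\<in>T. of_nat (c x) * f x)"
proof -
  have p0: "p > 0" using p prime_gt_0_nat by blast
  have finG: "finite (carrier G)" using pG p0 card.infinite by fastforce
  define F where "F = {x \<in> E. \<forall>g\<in>carrier G. a g x = x}"
  define orb where "orb = (\<lambda>x. (\<lambda>g. a g x) ` carrier G)"
  have self: "x \<in> orb x" if "x \<in> E" for x
    unfolding orb_def using one[OF that] one_closed by (metis imageI)
  have orbE: "orb x \<subseteq> E" if "x \<in> E" for x using closed that by (auto simp: orb_def)
  have orb_eq: "orb y = orb x" if x: "x \<in> E" and y: "y \<in> orb x" for x y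
  proof -
    obtain h where h: "h \<in> carrier G" "y = a h x" using y by (auto simp: orb_def)
    have 1: "a g y = a (g \<otimes> h) x" if "g \<in> carrier G" for g using comp that h x by simp
    have 2: "a g x = a (g \<otimes> inv h) y" if g: "g \<in> carrier G" for g
    proof -
      have "a (g \<otimes> inv h) y = a (g \<otimes> inv h \<otimes> h) x" using 1 g h by simp
      then show ?thesis using g h by (simp add: m_assoc)
    qed
    show ?thesis
    proof
      show "orb y \<subseteq> orb x"
      proof
        fix z assume "z \<in> orb y"
        then obtain g where g: "g \<in> carrier G" "z = a g y" unfolding orb_def by blast
        then have "z = a (g \<otimes> h) x" using 1 by simp
        then show "z \<in> orb x" unfolding orb_def using g h m_closed by blast
      qed
      show "orb x \<subseteq> orb y"
      proof
        fix z assume "z \<in> orb x"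
        then obtain g where g: "g \<in> carrier G" "z = a g x" unfolding orb_def by blast
        then have "z = a (g \<otimes> inv h) y" using 2 by simp
        then show "z \<in> orb y" unfolding orb_def using g h m_closed inv_closed by blast
      qed
    qed
  qed
  have card_dvd: "card (orb x) dvd p ^ k" if x: "x \<in> E" for x
  proof -
    have "card (carrier G) = card ((\<lambda>g. a g x) ` carrier G) * card {g \<in> carrier G. a g x = x}"
    proof (rule card_eq_fibre_mult[OF finG])
      fix y assume "y \<in> (\<lambda>g. a g x) ` carrier G"
      then obtain h where h: "h \<in> carrier G" "y = a h x" by auto
      have undo: "a (inv h) (a h x) = x" using comp[of "inv h" h x] h x one by simp
      have "bij_betw (\<lambda>g. h \<otimes> g) {g \<in> carrier G. a g x = x} {g \<in> carrier G. a g x = y}"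
        by (rule bij_betw_byWitness[where f' = "\<lambda>g. inv h \<otimes> g"])
          (use h x comp undo in \<open>auto simp: m_assoc[symmetric]\<close>)
      then show "card {g \<in> carrier G. a g x = y} = card {g \<in> carrier G. a g x = x}"
        by (simp add: bij_betw_same_card)
    qed
    then show ?thesis unfolding orb_def pG[symmetric] by simp
  qed
  have pdvd: "p dvd card (orb x)" if x: "x \<in> E" "x \<notin> F" for x
  proof -
    obtain g where g: "g \<in> carrier G" "a g x \<noteq> x" using x by (auto simp: F_def)
    have "a g x \<in> orb x" using g by (auto simp: orb_def)
    have "card (orb x) \<noteq> 1"
    proof
      assume "card (orb x) = 1"
      then obtain z where "orb x = {z}" using card_1_singletonE by blast
      then show False using g \<open>a g x \<in> orb x\<close> self[OF x(1)] by auto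
    qed
    moreover obtain i where "card (orb x) = p ^ i"
      using card_dvd[OF x(1)] divides_primepow_nat[OF p] by blast
    ultimately show ?thesis by (cases i) auto
  qed
  define E' where "E' = E - F"
  have orbE': "orb x \<subseteq> E'" if x: "x \<in> E'" for x
  proof
    fix y assume y: "y \<in> orb x"
    have "y \<notin> F"
    proof
      assume "y \<in> F"
      then have "orb y = {y}" using one_closed by (auto simp: F_def orb_def image_iff)
      then have "x = y" using orb_eq[OF _ y] self[of x] x by (auto simp: E'_def)
      then show False using x \<open>y \<in> F\<close> by (simp add: E'_def)
    qed
    then show "y \<in> E'" using y orbE[of x] x by (auto simp: E'_def)
  qed
  define r where "r = (\<lambda>C. SOME x. x \<in> E' \<and> orb x = (C :: 'e set))"
  have r: "r C \<in> E' \<and> orb (r C) = C" if "C \<in> orb ` E'" for C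
    unfolding r_def by (rule someI_ex) (use that in blast)
  have finE': "finite E'" using finE by (simp add: E'_def)
  define T where "T = r ` (orb ` E')"
  define c where "c = (\<lambda>x. card (orb x) div p)"
  have inj: "inj_on r (orb ` E')" using r by (metis inj_on_def)
  have "(\<Sum>x\<in>E'. f x) = (\<Sum>C\<in>orb ` E'. \<Sum>x\<in>{x \<in> E'. orb x = C}. f x)"
    by (rule sum.image_gen[OF finE'])
  also have "\<dots> = (\<Sum>C\<in>orb ` E'. of_nat p * (of_nat (c (r C)) * f (r C)))"
  proof (rule sum.cong[OF refl])
    fix C assume C: "C \<in> orb ` E'"
    let ?y = "r C"
    have y: "?y \<in> E'" "orb ?y = C" using r[OF C] by auto
    then have yE: "?y \<in> E" "?y \<notin> F" by (auto simp: E'_def)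
    have "{x \<in> E'. orb x = C} = orb ?y"
      using self orb_eq[OF yE(1)] orbE'[OF y(1)] y by (auto simp: E'_def)
    moreover have "f x = f ?y" if "x \<in> orb ?y" for x
      using that inv yE by (auto simp: orb_def)
    ultimately have "(\<Sum>x\<in>{x \<in> E'. orb x = C}. f x) = of_nat (card (orb ?y)) * f ?y" by simp
    also have "card (orb ?y) = p * c ?y" using pdvd[OF yE] by (simp add: c_def)
    finally show "(\<Sum>x\<in>{x \<in> E'. orb x = C}. f x) = of_nat p * (of_nat (c ?y) * f ?y)"
      by (simp add: mult.assoc)
  qed
  also have "\<dots> = of_nat p * (\<Sum>C\<in>orb ` E'. of_nat (c (r C)) * f (r C))" by (simp add: sum_distrib_left)
  also have "(\<Sum>C\<in>orb ` E'. of_nat (c (r C)) * f (r C)) = (\<Sum>x\<in>T. of_nat (c x) * f x)"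
    unfolding T_def by (simp add: sum.reindex[OF inj])
  finally have "(\<Sum>x\<in>E'. f x) = of_nat p * (\<Sum>x\<in>T. of_nat (c x) * f x)" .
  moreover have "(\<Sum>x\<in>E. f x) = (\<Sum>x\<in>F. f x) + (\<Sum>x\<in>E'. f x)"
    unfolding E'_def using finE by (subst add.commute, intro sum.subset_diff) (auto simp: F_def)
  moreover have "T \<subseteq> E" using r by (auto simp: T_def E'_def)
  ultimately show ?thesis using that[of T c] by (simp add: F_def)
qed

section \<open>Cyclotomic integers\<close>

text \<open>The ring \<open>\<int>[\<zeta>]\<close> with \<open>\<zeta>\<close> a primitive \<open>N\<close>-th root of unity. Traces of representations of a group of order
\<open>N\<close> lie in it, and a congruence modulo \<open>p\<close> between integers may be checked in it.\<close>

definition cyclotomic_integers :: "nat \<Rightarrow> complex set" where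
  "cyclotomic_integers N = {\<Sum>i<N. of_int (c i) * cis (2 * pi / real N) ^ i | c. True}"

lemma cyclotomic_integers_root:
  assumes N: "N > 0" and d: "d ^ N = (1::complex)"
  shows "d \<in> cyclotomic_integers N"
proof -
  have "d \<in> {z. z ^ N = 1}" using d by simp
  then obtain k where k: "k < N" "d = cis (2 * pi * real k / real N)"
    using bij_betw_imp_surj_on[OF bij_betw_roots_unity[OF N]] by (metis (no_types, lifting) imageE lessThan_iff)
  have "d = cis (2 * pi / real N) ^ k"
    using k by (simp add: DeMoivre mult_ac)
  also have "\<dots> = (\<Sum>i<N. of_int (if i = k then 1 else 0) * cis (2 * pi / real N) ^ i)"
  proof -
    have "(\<Sum>i<N. of_int (if i = k then 1 else 0) * cis (2 * pi / real N) ^ i) =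
        (\<Sum>i<N. if i = k then cis (2 * pi / real N) ^ i else 0)"
      by (intro sum.cong) auto
    then show ?thesis using k(1) by simp
  qed
  finally show ?thesis unfolding cyclotomic_integers_def
    by (intro CollectI exI[of _ "\<lambda>i. if i = k then 1 else 0"]) simp
qed

lemma cyclotomic_integers_add:
  assumes "x \<in> cyclotomic_integers N" "y \<in> cyclotomic_integers N"
  shows "x + y \<in> cyclotomic_integers N"
proof -
  obtain c d where "x = (\<Sum>i<N. of_int (c i) * cis (2 * pi / real N) ^ i)"
    "y = (\<Sum>i<N. of_int (d i) * cis (2 * pi / real N) ^ i)"
    using assms by (auto simp: cyclotomic_integers_def)
  then have "x + y = (\<Sum>i<N. of_int (c i + d i) * cis (2 * pi / real N) ^ i)"
    by (simp add: sum.distrib algebra_simps)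
  then show ?thesis unfolding cyclotomic_integers_def
    by (intro CollectI exI[of _ "\<lambda>i. c i + d i"]) simp
qed

lemma cyclotomic_integers_smult:
  assumes "x \<in> cyclotomic_integers N"
  shows "of_int m * x \<in> cyclotomic_integers N"
proof -
  obtain c where "x = (\<Sum>i<N. of_int (c i) * cis (2 * pi / real N) ^ i)"
    using assms by (auto simp: cyclotomic_integers_def)
  then have "of_int m * x = (\<Sum>i<N. of_int (m * c i) * cis (2 * pi / real N) ^ i)"
    by (simp add: sum_distrib_left algebra_simps)
  then show ?thesis unfolding cyclotomic_integers_def
    by (intro CollectI exI[of _ "\<lambda>i. m * c i"]) simp
qed

lemma cyclotomic_integers_sum:
  assumes "\<And>x. x \<in> S \<Longrightarrow> f x \<in> cyclotomic_integers N"
  shows "(\<Sum>x\<in>S. f x) \<in> cyclotomic_integers N"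
proof -
  have "0 \<in> cyclotomic_integers N"
    unfolding cyclotomic_integers_def by (intro CollectI exI[of _ "\<lambda>_. 0"]) simp
  then show ?thesis using assms
    by (induction S rule: infinite_finite_induct) (auto intro: cyclotomic_integers_add)
qed

text \<open>Multiplication by \<open>y\<close> maps the powers of \<open>w = \<zeta>\<close> to integral combinations of these powers: the vector
\<open>v\<close> of powers is an eigenvector, for the eigenvalue \<open>y\<close>, of a circulant integer matrix \<open>A\<close>. Hence \<open>y\<close> is
a root of the monic integral polynomial \<open>char_poly A\<close>.\<close>

lemma cyclotomic_integer_algebraic_int:
  assumes N: "N > 0" and y: "y \<in> cyclotomic_integers N"
  shows "algebraic_int y"
proof -
  define w where "w = cis (2 * pi / real N)"
  obtain c where c: "y = (\<Sum>i<N. of_int (c i) * w ^ i)"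
    using y by (auto simp: cyclotomic_integers_def w_def)
  have wN: "w ^ N = 1" using N by (simp add: w_def DeMoivre)
  have wmod: "w ^ (a mod N) = w ^ a" for a
  proof -
    have "w ^ a = w ^ (N * (a div N) + a mod N)" by simp
    then show ?thesis using wN by (simp only: power_add power_mult power_one mult_1)
  qed
  define A where "A = mat N N (\<lambda>(i,j). c ((j + (N - i)) mod N))"
  define A' where "A' = map_mat (of_int :: int \<Rightarrow> complex) A"
  have A: "A \<in> carrier_mat N N" and A': "A' \<in> carrier_mat N N" by (auto simp: A_def A'_def)
  define v where "v = vec N (\<lambda>j. w ^ j)"
  have "A' *\<^sub>v v = y \<cdot>\<^sub>v v"
  proof (rule eq_vecI)
    fix i assume "i < dim_vec (y \<cdot>\<^sub>v v)"
    then have i: "i < N" by (simp add: v_def)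
    have "(A' *\<^sub>v v) $ i = (\<Sum>j<N. of_int (c ((j + (N - i)) mod N)) * w ^ j)"
      using i by (auto simp: A'_def A_def v_def scalar_prod_def atLeast0LessThan)
    also have "\<dots> = (\<Sum>l<N. of_int (c l) * w ^ l * w ^ i)"
    proof (rule sum.reindex_bij_witness[where i = "\<lambda>l. (l + i) mod N" and j = "\<lambda>j. (j + (N - i)) mod N"])
      fix j assume j: "j \<in> {..<N}"
      have "((j + (N - i)) mod N + i) mod N = (j + (N - i) + i) mod N" by (rule mod_add_left_eq)
      also have "\<dots> = j" using i j by simp
      finally show "((j + (N - i)) mod N + i) mod N = j" .
      show "(j + (N - i)) mod N \<in> {..<N}" using N by simp
      have "w ^ ((j + (N - i)) mod N) * w ^ i = w ^ (j + (N - i) + i)" by (simp only: wmod power_add)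
      also have "\<dots> = w ^ j" using i wN by (simp add: power_add)
      finally show "of_int (c ((j + (N - i)) mod N)) * w ^ ((j + (N - i)) mod N) * w ^ i =
        of_int (c ((j + (N - i)) mod N)) * w ^ j" by (simp add: mult.assoc)
    next
      fix l assume l: "l \<in> {..<N}"
      have "((l + i) mod N + (N - i)) mod N = (l + i + (N - i)) mod N" by (rule mod_add_left_eq)
      also have "\<dots> = l" using i l by simp
      finally show "((l + i) mod N + (N - i)) mod N = l" .
      show "(l + i) mod N \<in> {..<N}" using N by simp
    qed
    also have "\<dots> = (y \<cdot>\<^sub>v v) $ i" using i by (simp add: c v_def sum_distrib_right)
    finally show "(A' *\<^sub>v v) $ i = (y \<cdot>\<^sub>v v) $ i" .
  qed (use A' in \<open>auto simp: v_def\<close>)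
  moreover have "v \<noteq> 0\<^sub>v N"
  proof
    assume "v = 0\<^sub>v N"
    then have "v $ 0 = 0" using N by simp
    then show False using N by (simp add: v_def)
  qed
  ultimately have "eigenvalue A' y"
    using A' unfolding eigenvalue_def eigenvector_def by (intro exI[of _ v]) (auto simp: v_def)
  then have "poly (char_poly A') y = 0" using eigenvalue_root_char_poly[OF A'] by blast
  moreover have "char_poly A' = map_poly of_int (char_poly A)"
    unfolding A'_def by (rule of_int_hom.char_poly_hom[OF A])
  moreover have "lead_coeff (char_poly A) = 1" using degree_monic_char_poly[OF A] by auto
  ultimately show ?thesis unfolding algebraic_int_altdef_ipoly by metis
qed

lemma cyclotomic_integer_dvd:
  assumes N: "N > 0" and y: "y \<in> cyclotomic_integers N" and eq: "of_nat n = of_nat p * y" and p: "p > 0"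
  shows "p dvd n"
proof -
  have "y = of_nat n / of_nat p" using eq p by simp
  then have "y \<in> \<rat>" by simp
  then have "y \<in> \<int>" using rational_algebraic_int_is_int[OF cyclotomic_integer_algebraic_int[OF N y]] by blast
  then obtain z where "y = of_int z" by (auto elim: Ints_cases)
  then have "(of_int (int n) :: complex) = of_int (int p * z)" using eq by simp
  then have "int n = int p * z" by (simp only: of_int_eq_iff)
  then have "int p dvd int n" by simp
  then show ?thesis by simp
qed

lemma (in group) representation_trace_cyclotomic:
  assumes fin: "finite (carrier G)" and r: "representation G n \<rho>" and g: "g \<in> carrier G"
  shows "mat_trace (\<rho> g) \<in> cyclotomic_integers (card (carrier G))"
proof -
  have "\<rho> g ^\<^sub>m Coset.order G = 1\<^sub>m n"
    using representation_pow[OF r g, of "Coset.order G"] pow_order_eq_1[OF g] representationD(3)[OF r] by simp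
  moreover have pos: "Coset.order G > 0" using fin order_gt_0_iff_finite by blast
  ultimately obtain d where d: "\<And>i. i < n \<Longrightarrow> d i ^ Coset.order G = (1::complex)" "mat_trace (\<rho> g) = (\<Sum>i<n. d i)"
    using finite_order_mat[OF representationD(1)[OF r g], of "Coset.order G"] by metis
  show ?thesis unfolding d(2) Coset.order_def[symmetric]
    by (rule cyclotomic_integers_sum) (use cyclotomic_integers_root[OF pos] d(1) in auto)
qed

section \<open>Irreducible representations of p-groups\<close>

lemma root_of_unity_coprime_orders:
  fixes c :: complex
  assumes "c ^ a = 1" "c ^ b = 1" "coprime a b"
  shows "c = 1"
proof (cases "a = 0")
  case True
  then show ?thesis using assms by simp
next
  case False
  then obtain x y where xy: "a * x = b * y + gcd a b" using bezout_nat by blast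
  have "1 = c ^ (a * x)" using assms by (simp add: power_mult)
  also have "\<dots> = c ^ (b * y) * c" using xy assms by (simp add: coprime_iff_gcd_eq_1)
  also have "\<dots> = c" using assms by (simp add: power_mult)
  finally show ?thesis by simp
qed

lemma smult_one_pow_mat:
  fixes c :: complex
  shows "(c \<cdot>\<^sub>m 1\<^sub>m n) ^\<^sub>m k = c ^ k \<cdot>\<^sub>m 1\<^sub>m n"
proof (induction k)
  case (Suc k)
  have "(c \<cdot>\<^sub>m 1\<^sub>m n) ^\<^sub>m Suc k = (c ^ k \<cdot>\<^sub>m 1\<^sub>m n) * (c \<cdot>\<^sub>m 1\<^sub>m n)" using Suc by simp
  also have "\<dots> = c ^ Suc k \<cdot>\<^sub>m 1\<^sub>m n"
    by (rule eq_matI) (auto simp: scalar_prod_def if_distrib sum.delta' cong: if_cong)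
  finally show ?case .
qed (auto intro!: eq_matI)

lemma (in group) representation_fibre_sum:
  fixes f :: "complex mat \<Rightarrow> 'c::comm_semiring_1"
  assumes r: "representation G n \<rho>" and B: "subgroup B G" and fin: "finite B"
  shows "(\<Sum>x\<in>B. f (\<rho> x)) = of_nat (card {x \<in> B. \<rho> x = 1\<^sub>m n}) * (\<Sum>M\<in>\<rho> ` B. f M)"
proof -
  interpret B: subgroup B G by (rule B)
  have "(\<Sum>x\<in>B. f (\<rho> x)) = (\<Sum>M\<in>\<rho> ` B. \<Sum>x\<in>{x \<in> B. \<rho> x = M}. f (\<rho> x))"
    by (rule sum.image_gen[OF fin])
  also have "\<dots> = (\<Sum>M\<in>\<rho> ` B. of_nat (card {x \<in> B. \<rho> x = 1\<^sub>m n}) * f M)"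
  proof (rule sum.cong[OF refl])
    fix M assume "M \<in> \<rho> ` B"
    then obtain b where b: "b \<in> B" "M = \<rho> b" by blast
    have bG: "b \<in> carrier G" using b by simp
    note rb = representationD(1)[OF r bG]
    have "bij_betw (\<lambda>z. b \<otimes> z) {x \<in> B. \<rho> x = 1\<^sub>m n} {x \<in> B. \<rho> x = M}"
    proof (rule bij_betw_byWitness[where f' = "\<lambda>z. inv b \<otimes> z"])
      show "\<forall>z\<in>{x \<in> B. \<rho> x = 1\<^sub>m n}. inv b \<otimes> (b \<otimes> z) = z" "\<forall>z\<in>{x \<in> B. \<rho> x = M}. b \<otimes> (inv b \<otimes> z) = z"
        using bG by (auto simp: mult_inv_cancel)
      show "(\<otimes>) b ` {x \<in> B. \<rho> x = 1\<^sub>m n} \<subseteq> {x \<in> B. \<rho> x = M}"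
        using b bG rb representationD(2)[OF r] by auto
      show "(\<otimes>) (inv b) ` {x \<in> B. \<rho> x = M} \<subseteq> {x \<in> B. \<rho> x = 1\<^sub>m n}"
        using b bG representation_inv[OF r bG] representationD(2)[OF r] by auto
    qed
    then have "card {x \<in> B. \<rho> x = M} = card {x \<in> B. \<rho> x = 1\<^sub>m n}" by (simp add: bij_betw_same_card)
    then show "(\<Sum>x\<in>{x \<in> B. \<rho> x = M}. f (\<rho> x)) = of_nat (card {x \<in> B. \<rho> x = 1\<^sub>m n}) * f M"
      by simp
  qed
  also have "\<dots> = of_nat (card {x \<in> B. \<rho> x = 1\<^sub>m n}) * (\<Sum>M\<in>\<rho> ` B. f M)"
    by (simp add: sum_distrib_left)
  finally show ?thesis .
qed

text \<open>The class equation for the conjugation action of \<open>P\<close> on the matrices \<open>\<rho> ` B\<close>. Working with matrices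
instead of elements of \<open>B\<close> amounts to passing to the quotient of \<open>B\<close> by the kernel of \<open>\<rho>\<close> on \<open>B\<close>.\<close>

lemma (in group) conjugation_class_sum:
  fixes f :: "complex mat \<Rightarrow> 'c::comm_semiring_1"
  assumes p: "Factorial_Ring.prime p" and P: "subgroup P G" and pP: "card P = p ^ k"
    and B: "B \<lhd> G" and finB: "finite B" and r: "representation G n \<rho>"
    and inv: "\<And>g b. g \<in> P \<Longrightarrow> b \<in> B \<Longrightarrow> f (\<rho> g * \<rho> b * \<rho> (inv g)) = f (\<rho> b)"
  obtains T c where "T \<subseteq> \<rho> ` B"
    "(\<Sum>M\<in>\<rho> ` B. f M) = (\<Sum>M\<in>{M \<in> \<rho> ` B. \<forall>g\<in>P. \<rho> g * M = M * \<rho> g}. f M)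
        + of_nat p * (\<Sum>M\<in>T. of_nat (c M) * f M)"
proof -
  interpret P: subgroup P G by (rule P)
  interpret B: normal B G by (rule B)
  interpret PG: group "G\<lparr>carrier := P\<rparr>" using P by (rule subgroup_imp_group)
  define a where "a = (\<lambda>g M. \<rho> g * M * \<rho> (inv g))"
  note rc = representationD(1)[OF r]
  have cl: "a g (\<rho> b) = \<rho> (g \<otimes> b \<otimes> inv g)" if "g \<in> P" "b \<in> B" for g b
    using that representationD(2)[OF r] by (simp add: a_def)
  have fixed: "a g M = M \<longleftrightarrow> \<rho> g * M = M * \<rho> g" if g: "g \<in> P" and M: "M \<in> \<rho> ` B" for g M
  proof -
    have gG: "g \<in> carrier G" using g by simp
    have Mc: "M \<in> carrier_mat n n" using M rc by auto
    note c = rc[OF gG] rc[OF inv_closed[OF gG]]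
    have 1: "a g M * \<rho> g = \<rho> g * M"
    proof -
      have "a g M * \<rho> g = \<rho> g * M * (\<rho> (inv g) * \<rho> g)"
        unfolding a_def by (rule assoc_mult_mat) (use c Mc in auto)
      then show ?thesis using representation_inv[OF r gG] c Mc by simp
    qed
    have 2: "M * \<rho> g * \<rho> (inv g) = M"
    proof -
      have "M * \<rho> g * \<rho> (inv g) = M * (\<rho> g * \<rho> (inv g))"
        by (rule assoc_mult_mat) (use c Mc in auto)
      then show ?thesis using representation_inv[OF r gG] Mc by simp
    qed
    show ?thesis using 1 2 unfolding a_def by metis
  qed
  have *: "{M \<in> \<rho> ` B. \<forall>g\<in>carrier (G\<lparr>carrier := P\<rparr>). a g M = M} = {M \<in> \<rho> ` B. \<forall>g\<in>P. \<rho> g * M = M * \<rho> g}"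
    using fixed by auto
  have conjB: "g \<otimes> b \<otimes> inv g \<in> B" if "g \<in> P" "b \<in> B" for g b
    using B.inv_op_closed2[of g b] that by simp
  show ?thesis
  proof (rule PG.p_group_action_sum[where a = a and E = "\<rho> ` B" and f = f, OF p _ finite_imageI[OF finB]])
    show "card (carrier (G\<lparr>carrier := P\<rparr>)) = p ^ k" using pP by simp
    show "a g M \<in> \<rho> ` B" if g: "g \<in> carrier (G\<lparr>carrier := P\<rparr>)" and M: "M \<in> \<rho> ` B" for g M
    proof -
      have gP: "g \<in> P" using g by simp
      obtain b where b: "b \<in> B" "M = \<rho> b" using M by blast
      then show ?thesis using cl[OF gP b(1)] conjB[OF gP b(1)] by simp
    qed
    show "a \<one>\<^bsub>G\<lparr>carrier := P\<rparr>\<^esub> M = M" if "M \<in> \<rho> ` B" for M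
    proof -
      obtain b where b: "b \<in> B" "M = \<rho> b" using \<open>M \<in> \<rho> ` B\<close> by blast
      then show ?thesis using cl[OF P.one_closed b(1)] by simp
    qed
    show "a (g \<otimes>\<^bsub>G\<lparr>carrier := P\<rparr>\<^esub> h) M = a g (a h M)"
      if gh: "g \<in> carrier (G\<lparr>carrier := P\<rparr>)" "h \<in> carrier (G\<lparr>carrier := P\<rparr>)" and M: "M \<in> \<rho> ` B" for g h M
    proof -
      have P': "g \<in> P" "h \<in> P" using gh by auto
      obtain b where b: "b \<in> B" "M = \<rho> b" using M by blast
      have bG: "b \<in> carrier G" using b by simp
      have "a (g \<otimes> h) M = \<rho> (g \<otimes> h \<otimes> b \<otimes> inv (g \<otimes> h))" using cl[of "g \<otimes> h" b] b P' by simp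
      also have "g \<otimes> h \<otimes> b \<otimes> inv (g \<otimes> h) = g \<otimes> (h \<otimes> b \<otimes> inv h) \<otimes> inv g"
        using P' bG by (simp add: inv_mult_group m_assoc)
      also have "\<rho> \<dots> = a g (a h M)" using cl[OF P'(1) conjB[OF P'(2) b(1)]] cl[OF P'(2) b(1)] b by simp
      finally show ?thesis by simp
    qed
    show "f (a g M) = f M" if "g \<in> carrier (G\<lparr>carrier := P\<rparr>)" "M \<in> \<rho> ` B" for g M
      using that inv by (auto simp: a_def)
    fix T c assume "T \<subseteq> \<rho> ` B" "(\<Sum>M\<in>\<rho> ` B. f M) =
      (\<Sum>M\<in>{M \<in> \<rho> ` B. \<forall>g\<in>carrier (G\<lparr>carrier := P\<rparr>). a g M = M}. f M) + of_nat p * (\<Sum>M\<in>T. of_nat (c M) * f M)"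
    then show ?thesis unfolding * using that by blast
  qed
qed

lemma (in group) det_representation_derived:
  assumes r: "representation G n \<rho>" and d: "d \<in> derived G (carrier G)"
  shows "det (\<rho> d) = 1"
proof -
  have dm: "det (\<rho> (g \<otimes> h)) = det (\<rho> g) * det (\<rho> h)" if "g \<in> carrier G" "h \<in> carrier G" for g h
    using representationD(2)[OF r that] det_mult[OF representationD(1)[OF r that(1)] representationD(1)[OF r that(2)]] by simp
  have di: "det (\<rho> g) * det (\<rho> (inv g)) = 1" if "g \<in> carrier G" for g
    using dm[of g "inv g"] that representationD(3)[OF r] by simp
  have c: "det (\<rho> h) = 1 \<and> h \<in> carrier G" if h: "h \<in> derived_set G (carrier G)" for h
  proof -
    obtain a b where ab: "a \<in> carrier G" "b \<in> carrier G" "h = a \<otimes> b \<otimes> inv a \<otimes> inv b" using h by blast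
    have "det (\<rho> h) = (det (\<rho> a) * det (\<rho> (inv a))) * (det (\<rho> b) * det (\<rho> (inv b)))"
      using ab by (simp add: dm mult_ac)
    then show ?thesis using di ab by simp
  qed
  from d have "d \<in> generate G (derived_set G (carrier G))" by (simp add: derived_def)
  then have "det (\<rho> d) = 1 \<and> d \<in> carrier G"
  proof (induction rule: generate.induct)
    case one
    then show ?case using representationD(3)[OF r] by simp
  next
    case (incl h)
    then show ?case using c by blast
  next
    case (inv h)
    then have "det (\<rho> h) = 1" "h \<in> carrier G" using c by blast+
    then show ?case using di[of h] by simp
  next
    case (eng h1 h2)
    then show ?case using dm by simp
  qed
  then show ?thesis by simp
qed

text \<open>Let \<open>D\<close> be the derived subgroup. A matrix in \<open>\<sigma> ` D\<close> that commutes with all \<open>\<sigma> g\<close> is a scalar \<open>c\<close> by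
Schur's lemma. Then \<open>c\<^sup>n = 1\<close>, since determinants are trivial on commutators, and \<open>c\<close> has \<open>p\<close>-power
order; as \<open>n\<close> is prime to \<open>p\<close>, \<open>c = 1\<close>. So the \<open>p\<close>-group \<open>\<sigma> ` D\<close> contains only one element that is fixed under
conjugation by \<open>G\<close>. Its order is therefore congruent to \<open>1\<close> modulo \<open>p\<close>, and it is trivial.\<close>

lemma (in group) p_group_irreducible_derived:
  assumes p: "Factorial_Ring.prime p" and pG: "card (carrier G) = p ^ k"
    and irr: "irreducible_representation G n \<sigma>" and pn: "\<not> p dvd n"
    and x: "x \<in> derived G (carrier G)"
  shows "\<sigma> x = 1\<^sub>m n"
proof -
  have p0: "p > 0" using p prime_gt_0_nat by blast
  have finG: "finite (carrier G)" using pG p0 card.infinite by fastforce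
  have n: "n > 0" and r: "representation G n \<sigma>" using irr by (auto simp: irreducible_representation_def)
  define D where "D = derived G (carrier G)"
  have "carrier G \<lhd> G" by (rule normal_invI) (auto simp: subgroup_self)
  then have D: "D \<lhd> G" unfolding D_def by (rule derived_is_normal)
  interpret D: normal D G by (rule D)
  have finD: "finite D" using finG D.subset finite_subset by blast
  have fixed: "{M \<in> \<sigma> ` D. \<forall>g\<in>carrier G. \<sigma> g * M = M * \<sigma> g} = {1\<^sub>m n}"
  proof
    have "1\<^sub>m n \<in> \<sigma> ` D" using representationD(3)[OF r] D.one_closed by (metis imageI)
    moreover have "\<sigma> g * 1\<^sub>m n = 1\<^sub>m n * \<sigma> g" if "g \<in> carrier G" for g
      using representationD(1)[OF r that] by simp
    ultimately show "{1\<^sub>m n} \<subseteq> {M \<in> \<sigma> ` D. \<forall>g\<in>carrier G. \<sigma> g * M = M * \<sigma> g}"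
      by blast
    show "{M \<in> \<sigma> ` D. \<forall>g\<in>carrier G. \<sigma> g * M = M * \<sigma> g} \<subseteq> {1\<^sub>m n}"
    proof
      fix M assume "M \<in> {M \<in> \<sigma> ` D. \<forall>g\<in>carrier G. \<sigma> g * M = M * \<sigma> g}"
      then obtain d where d: "d \<in> D" "M = \<sigma> d" and cm: "\<forall>g\<in>carrier G. \<sigma> g * M = M * \<sigma> g" by blast
      have dG: "d \<in> carrier G" using d by simp
      obtain c where c: "M = c \<cdot>\<^sub>m 1\<^sub>m n"
        using schur_scalar[OF irr, of M] representationD(1)[OF r dG] cm d by metis
      have "c ^ n = 1" 
      proof -
        have "det (c \<cdot>\<^sub>m 1\<^sub>m n) = 1"
          using det_representation_derived[OF r, of d] d(1) unfolding D_def d(2)[symmetric] c by simp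
        then show ?thesis by simp
      qed
      moreover have "c ^ (p ^ k) = 1"
      proof -
        have "M ^\<^sub>m (p ^ k) = 1\<^sub>m n"
          using representation_pow[OF r dG, of "p ^ k"] pow_order_eq_1[OF dG] pG representationD(3)[OF r] d
          by (simp add: Coset.order_def)
        then have "(c ^ (p ^ k) \<cdot>\<^sub>m 1\<^sub>m n) $$ (0,0) = (1\<^sub>m n :: complex mat) $$ (0,0)"
          unfolding c smult_one_pow_mat by simp
        then show ?thesis using n by simp
      qed
      moreover have "coprime n (p ^ k)"
      proof -
        have "coprime n p" using prime_imp_coprime[OF p pn] coprime_commute by blast
        then show ?thesis by simp
      qed
      ultimately have "c = 1" by (rule root_of_unity_coprime_orders)
      then have "M = 1\<^sub>m n" using c by (auto intro!: eq_matI)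
      then show "M \<in> {1\<^sub>m n}" by simp
    qed
  qed
  obtain T c where "T \<subseteq> \<sigma> ` D" "(\<Sum>M\<in>\<sigma> ` D. 1) =
      (\<Sum>M\<in>{M \<in> \<sigma> ` D. \<forall>g\<in>carrier G. \<sigma> g * M = M * \<sigma> g}. 1) + of_nat p * (\<Sum>M\<in>T. of_nat (c M) * (1::nat))"
    by (rule conjugation_class_sum[OF p subgroup_self pG D finD r, of "\<lambda>_. 1::nat"]) (rule refl, rule that)
  then have one_mod: "card (\<sigma> ` D) = 1 + p * (\<Sum>M\<in>T. c M)" unfolding fixed by simp
  have "card D = card {x \<in> D. \<sigma> x = 1\<^sub>m n} * card (\<sigma> ` D)"
    using representation_fibre_sum[OF r normal_imp_subgroup[OF D] finD, of "\<lambda>_. 1::nat"] by simp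
  moreover have "card D dvd p ^ k"
    using card_subgroup_dvd[OF normal_imp_subgroup[OF D] subgroup_self D.subset] pG by simp
  ultimately have "card (\<sigma> ` D) dvd p ^ k" by (metis dvd_mult_right)
  then obtain i where i: "card (\<sigma> ` D) = p ^ i" using divides_primepow_nat[OF p] by blast
  have "i = 0"
  proof (rule ccontr)
    assume "i \<noteq> 0"
    then have "p dvd card (\<sigma> ` D)" using i by simp
    then have "p dvd 1 + p * (\<Sum>M\<in>T. c M)" using one_mod by simp
    then have "p dvd 1" by (metis dvd_add_left_iff dvd_triv_left)
    then show False using p by (simp add: prime_nat_iff)
  qed
  then have "card (\<sigma> ` D) = 1" using i by simp
  then obtain M where "\<sigma> ` D = {M}" using card_1_singletonE by blast
  then have "\<sigma> x \<in> {M}" "\<sigma> \<one> \<in> {M}"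
    using imageI[of x D \<sigma>] imageI[of \<one> D \<sigma>] x D.one_closed by (simp_all add: D_def)
  then have "\<sigma> x = \<sigma> \<one>" by simp
  then show ?thesis using representationD(3)[OF r] by simp
qed

section \<open>Sections of a normal subgroup\<close>

text \<open>The conjugacy part of Sylow's theorem for the group \<open>AP\<close>, with a conjugating element taken from \<open>A\<close>.
The \<open>p\<close>-group \<open>R\<close> permutes the left cosets \<open>a P\<close> with \<open>a \<in> A\<close>, whose number divides \<open>|G : P|\<close> and so
is prime to \<open>p\<close>; hence it fixes one of them.\<close>

lemma (in group) conjugate_into_sylow:
  assumes fin: "finite (carrier G)" and p: "Factorial_Ring.prime p" and A: "A \<lhd> G"
    and P: "subgroup P G" and index: "card (carrier G) = q * card P" "\<not> p dvd q"
    and R: "subgroup R G" and pR: "card R = p ^ j" and RAP: "R \<subseteq> A <#> P"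
  obtains a where "a \<in> A" "\<And>r. r \<in> R \<Longrightarrow> inv a \<otimes> r \<otimes> a \<in> P"
proof -
  interpret P: subgroup P G by (rule P)
  interpret R: subgroup R G by (rule R)
  interpret A: normal A G by (rule A)
  have As: "subgroup A G" using A normal_imp_subgroup by blast
  have finA: "finite A" using fin A.subset finite_subset by blast
  have finP: "finite P" using fin P.subset finite_subset by blast
  define S where "S = (\<lambda>a. l_coset G a P) ` A"
  have finS: "finite S" using finA by (simp add: S_def)
  have "card A = card S * card (A \<inter> P)" unfolding S_def
  proof (rule card_eq_fibre_mult[OF finA])
    fix C assume "C \<in> (\<lambda>a. l_coset G a P) ` A"
    then obtain a where a: "a \<in> A" "C = l_coset G a P" by blast
    have aG: "a \<in> carrier G" using a by simp
    have "bij_betw (\<lambda>z. a \<otimes> z) (A \<inter> P) {b \<in> A. l_coset G b P = C}"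
    proof (rule bij_betw_byWitness[where f' = "\<lambda>b. inv a \<otimes> b"])
      show "\<forall>z\<in>A \<inter> P. inv a \<otimes> (a \<otimes> z) = z" using aG by (auto simp: mult_inv_cancel)
      show "\<forall>z\<in>{b \<in> A. l_coset G b P = C}. a \<otimes> (inv a \<otimes> z) = z" using aG by (auto simp: mult_inv_cancel)
      show "(\<otimes>) a ` (A \<inter> P) \<subseteq> {b \<in> A. l_coset G b P = C}"
      proof (intro subsetI, elim imageE)
        fix u z assume z: "z \<in> A \<inter> P" and u: "u = a \<otimes> z"
        have "u \<in> l_coset G a P" using z u by (auto simp: l_coset_def)
        then have "l_coset G u P = C" using l_repr_independence[OF _ aG P] a by simp
        then show "u \<in> {b \<in> A. l_coset G b P = C}" using z u a by simp
      qed
      show "(\<otimes>) (inv a) ` {b \<in> A. l_coset G b P = C} \<subseteq> A \<inter> P"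
      proof (intro subsetI, elim imageE)
        fix u z assume z: "z \<in> {b \<in> A. l_coset G b P = C}" and u: "u = inv a \<otimes> z"
        then have zA: "z \<in> A" and zC: "l_coset G z P = l_coset G a P" using a by auto
        have "z \<in> l_coset G a P" using lcos_self[OF A.mem_carrier[OF zA] P] zC by simp
        then show "u \<in> A \<inter> P" using P.lcos_module_imp[OF is_group aG] u a zA by auto
      qed
    qed
    then show "card {b \<in> A. l_coset G b P = C} = card (A \<inter> P)" by (simp add: bij_betw_same_card)
  qed
  moreover have "card (A <#> P) * card (A \<inter> P) = card A * card P" by (rule card_set_mult[OF fin As P])
  moreover have "card (A \<inter> P) > 0"
  proof -
    have "\<one> \<in> A \<inter> P" by simp
    then show ?thesis using finA card_gt_0_iff by blast
  qed
  ultimately have "card (A <#> P) = card S * card P" by (simp add: mult_ac)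
  moreover have "card (A <#> P) dvd card (carrier G)"
    using card_subgroup_dvd[OF mult_norm_subgroup[OF A P] subgroup_self]
      subgroup.subset[OF mult_norm_subgroup[OF A P]] by blast
  moreover have "card P > 0" using finP P.one_closed card_gt_0_iff by blast
  ultimately have "card S dvd q" using index by simp
  then have pS: "\<not> p dvd card S" using index dvd_trans by blast
  interpret RG: group "G\<lparr>carrier := R\<rparr>" using R by (rule subgroup_imp_group)
  have act: "l_coset G r C \<in> S" if r: "r \<in> R" and C: "C \<in> S" for r C
  proof -
    obtain a where a: "a \<in> A" "C = l_coset G a P" using C by (auto simp: S_def)
    obtain a1 x1 where r1: "a1 \<in> A" "x1 \<in> P" "r = a1 \<otimes> x1" using r RAP by (auto simp: set_mult_def)
    have G: "a \<in> carrier G" "a1 \<in> carrier G" "x1 \<in> carrier G" "r \<in> carrier G" using a r1 r by auto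
    let ?b = "a1 \<otimes> (x1 \<otimes> a \<otimes> inv x1)"
    have bA: "?b \<in> A" using r1 a G A.inv_op_closed2 by auto
    have "r \<otimes> a = ?b \<otimes> x1" using r1 G by (simp add: m_assoc)
    then have "r \<otimes> a \<in> l_coset G ?b P" using r1 by (auto simp: l_coset_def)
    then have "l_coset G ?b P = l_coset G (r \<otimes> a) P"
      using l_repr_independence[OF _ _ P] bA by simp
    then show ?thesis using lcos_m_assoc[OF P.subset G(4,1)] a bA by (auto simp: S_def)
  qed
  have SG: "C \<subseteq> carrier G" if C: "C \<in> S" for C
  proof -
    obtain a where "a \<in> A" "C = l_coset G a P" using C by (auto simp: S_def)
    then show ?thesis using l_coset_subset_G[OF P.subset, of a] by simp
  qed
  have "\<exists>C\<in>S. \<forall>r\<in>R. l_coset G r C = C"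
  proof (rule ccontr)
    assume "\<not> ?thesis"
    then have e: "{C \<in> S. \<forall>r\<in>carrier (G\<lparr>carrier := R\<rparr>). l_coset G r C = C} = {}" by auto
    show False
    proof (rule RG.p_group_action_sum[where a = "l_coset G" and E = S and f = "\<lambda>_. 1::nat", OF p _ finS])
      show "card (carrier (G\<lparr>carrier := R\<rparr>)) = p ^ j" using pR by simp
      show "l_coset G r C \<in> S" if "r \<in> carrier (G\<lparr>carrier := R\<rparr>)" "C \<in> S" for r C
        using that act by simp
      show "l_coset G \<one>\<^bsub>G\<lparr>carrier := R\<rparr>\<^esub> C = C" if "C \<in> S" for C
        using lcos_mult_one[OF SG[OF that]] by simp
      show "l_coset G (r \<otimes>\<^bsub>G\<lparr>carrier := R\<rparr>\<^esub> s) C = l_coset G r (l_coset G s C)"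
        if "r \<in> carrier (G\<lparr>carrier := R\<rparr>)" "s \<in> carrier (G\<lparr>carrier := R\<rparr>)" "C \<in> S" for r s C
        using that lcos_m_assoc[OF SG[OF that(3)], of r s] by simp
      fix T c
      assume "(\<Sum>C\<in>S. 1) = (\<Sum>C\<in>{C \<in> S. \<forall>r\<in>carrier (G\<lparr>carrier := R\<rparr>). l_coset G r C = C}. 1)
        + of_nat p * (\<Sum>C\<in>T. of_nat (c C) * (1::nat))"
      then have "card S = p * (\<Sum>C\<in>T. c C)" unfolding e by simp
      then show False using pS by simp
    qed simp
  qed
  then obtain a where a: "a \<in> A" and fx: "\<And>r. r \<in> R \<Longrightarrow> l_coset G r (l_coset G a P) = l_coset G a P"
    by (auto simp: S_def)
  have aG: "a \<in> carrier G" using a by simp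
  have "inv a \<otimes> r \<otimes> a \<in> P" if r: "r \<in> R" for r
  proof -
    have rG: "r \<in> carrier G" using r by simp
    have "l_coset G (r \<otimes> a) P = l_coset G a P" using fx[OF r] lcos_m_assoc[OF P.subset rG aG] by simp
    then have "r \<otimes> a \<in> l_coset G a P" using lcos_self[of "r \<otimes> a", OF _ P] rG aG by simp
    then have "inv a \<otimes> (r \<otimes> a) \<in> P" using P.lcos_module_imp[OF is_group aG] by blast
    then show ?thesis using rG aG by (simp add: m_assoc)
  qed
  then show ?thesis using that a by blast
qed

text \<open>Let \<open>A\<close> be the kernel of \<open>\<rho>\<close> on \<open>B\<close>. If \<open>\<rho> b\<close> commutes with \<open>\<rho> ` P\<close>, then \<open>b\<close> centralizes \<open>P\<close> modulo \<open>A\<close>,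
so \<open>b P b\<inverse>\<close> lies in \<open>AP\<close>. By \<open>conjugate_into_sylow\<close>, \<open>b\<close> can be changed by an element of \<open>A\<close> so as to
normalize \<open>P\<close>; it then lies in \<open>P \<inter> B\<close>, and \<open>\<rho> b = 1\<close>. So \<open>1\<close> is the only fixed point of \<open>P\<close> on the
matrices \<open>\<rho> ` B\<close>, and their traces add up to \<open>n\<close> modulo \<open>p\<close>, which is not \<open>0\<close>.\<close>

lemma (in group) coprime_section_acts_trivially:
  assumes fin: "finite (carrier G)" and p: "Factorial_Ring.prime p"
    and P: "subgroup P G" and pP: "card P = p ^ k" and index: "card (carrier G) = q * card P" "\<not> p dvd q"
    and irr: "irreducible_representation G n \<rho>" and pn: "\<not> p dvd n"
    and B: "B \<lhd> G" and norm: "B \<inter> normalizer G P \<subseteq> P"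
    and BP: "\<And>x. x \<in> P \<inter> B \<Longrightarrow> \<rho> x = 1\<^sub>m n" and x: "x \<in> B"
  shows "\<rho> x = 1\<^sub>m n"
proof -
  interpret P: subgroup P G by (rule P)
  interpret B: normal B G by (rule B)
  have r: "representation G n \<rho>" using irr by (simp add: irreducible_representation_def)
  have Bs: "subgroup B G" using B normal_imp_subgroup by blast
  have finB: "finite B" using fin B.subset finite_subset by blast
  have finP: "finite P" using fin P.subset finite_subset by blast
  have p0: "p > 0" using p prime_gt_0_nat by blast
  have N: "card (carrier G) > 0" using fin by (auto simp: card_gt_0_iff)
  note rm = representationD(2)[OF r] and r1 = representationD(3)[OF r] and rc = representationD(1)[OF r]
  define A where "A = {x \<in> B. \<rho> x = 1\<^sub>m n}"
  have A: "A \<lhd> G"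
  proof (rule normal_invI)
    show "subgroup A G"
    proof (rule subgroupI)
      show "A \<subseteq> carrier G" using B.subset by (auto simp: A_def)
      show "A \<noteq> {}" using r1 B.one_closed unfolding A_def by blast
      show "inv a \<in> A" if "a \<in> A" for a
        using that representation_inv(1)[OF r, of a] rc[of "inv a"] by (auto simp: A_def)
      show "a \<otimes> b \<in> A" if "a \<in> A" "b \<in> A" for a b
        using that by (auto simp: A_def rm)
    qed
    show "g \<otimes> a \<otimes> inv g \<in> A" if "g \<in> carrier G" "a \<in> A" for g a
      using that B.inv_op_closed2 representation_inv(2)[OF r that(1)] rc[OF that(1)] by (auto simp: A_def rm)
  qed
  have fixed: "\<rho> b = 1\<^sub>m n" if b: "b \<in> B" and cm: "\<forall>g\<in>P. \<rho> g * \<rho> b = \<rho> b * \<rho> g" for b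
  proof -
    have bG: "b \<in> carrier G" using b by simp
    define R where "R = (\<lambda>x. b \<otimes> x \<otimes> inv b) ` P"
    have R: "subgroup R G"
    proof (rule subgroupI)
      show "R \<subseteq> carrier G" using bG by (auto simp: R_def)
      show "R \<noteq> {}" using P.one_closed unfolding R_def by blast
      show "inv u \<in> R" if "u \<in> R" for u
      proof -
        obtain y where y: "y \<in> P" "u = b \<otimes> y \<otimes> inv b" using \<open>u \<in> R\<close> by (auto simp: R_def)
        then have "inv u = b \<otimes> inv y \<otimes> inv b" using bG by (simp add: inv_mult_group m_assoc)
        then show ?thesis using y by (auto simp: R_def)
      qed
      show "u \<otimes> v \<in> R" if uv: "u \<in> R" "v \<in> R" for u v
      proof -
        obtain y z where y: "y \<in> P" "u = b \<otimes> y \<otimes> inv b" and z: "z \<in> P" "v = b \<otimes> z \<otimes> inv b"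
          using uv by (auto simp: R_def)
        then have "u \<otimes> v = b \<otimes> (y \<otimes> z) \<otimes> inv b" using bG by (simp add: m_assoc mult_inv_cancel)
        then show ?thesis using y z by (auto simp: R_def)
      qed
    qed
    have "inj_on (\<lambda>x. b \<otimes> x \<otimes> inv b) P" using bG by (auto intro!: inj_onI)
    then have cR: "card R = p ^ k" using pP by (simp add: R_def card_image)
    have "R \<subseteq> A <#> P"
    proof
      fix u assume "u \<in> R"
      then obtain y where y: "y \<in> P" "u = b \<otimes> y \<otimes> inv b" by (auto simp: R_def)
      have yG: "y \<in> carrier G" using y by simp
      \<comment> \<open>The commutator of \<open>b\<close> and \<open>y\<close>: it lies in \<open>B\<close>, and \<open>\<rho>\<close> kills it.\<close>
      let ?d = "b \<otimes> (y \<otimes> inv b \<otimes> inv y)"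
      have "?d \<in> B" using b B.inv_op_closed2[OF yG] by blast
      moreover have "\<rho> ?d = 1\<^sub>m n"
      proof -
        have "?d = b \<otimes> y \<otimes> inv (y \<otimes> b)" using bG yG by (simp add: inv_mult_group m_assoc)
        then have "\<rho> ?d = \<rho> b * \<rho> y * \<rho> (inv (y \<otimes> b))" using bG yG by (simp add: rm)
        also have "\<rho> b * \<rho> y = \<rho> (y \<otimes> b)" using cm y bG yG by (simp add: rm)
        finally show ?thesis using representation_inv(2)[OF r, of "y \<otimes> b"] bG yG by simp
      qed
      ultimately have "?d \<in> A" by (simp add: A_def)
      moreover have "u = ?d \<otimes> y" using y bG yG by (simp add: m_assoc)
      ultimately show "u \<in> A <#> P" using y by (auto simp: set_mult_def)
    qed
    then obtain a where a: "a \<in> A" and ca: "\<And>u. u \<in> R \<Longrightarrow> inv a \<otimes> u \<otimes> a \<in> P"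
      using conjugate_into_sylow[OF fin p A P index R cR] by metis
    have aB: "a \<in> B" and aG: "a \<in> carrier G" and ra: "\<rho> a = 1\<^sub>m n" using a by (auto simp: A_def)
    let ?y = "inv a \<otimes> b"
    have yB: "?y \<in> B" using aB b by blast
    have yG: "?y \<in> carrier G" using yB by simp
    have cy: "?y \<otimes> z \<otimes> inv ?y \<in> P" if "z \<in> P" for z
    proof -
      have "?y \<otimes> z \<otimes> inv ?y = inv a \<otimes> (b \<otimes> z \<otimes> inv b) \<otimes> a"
        using aG bG that by (simp add: inv_mult_group m_assoc)
      then show ?thesis using ca[of "b \<otimes> z \<otimes> inv b"] that by (auto simp: R_def)
    qed
    have "inj_on (\<lambda>z. ?y \<otimes> z \<otimes> inv ?y) P" using yG by (auto intro!: inj_onI)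
    then have "card ((\<lambda>z. ?y \<otimes> z \<otimes> inv ?y) ` P) = card P" by (rule card_image)
    moreover have "(\<lambda>z. ?y \<otimes> z \<otimes> inv ?y) ` P \<subseteq> P" using cy by blast
    ultimately have "(\<lambda>z. ?y \<otimes> z \<otimes> inv ?y) ` P = P" using finP card_subset_eq by blast
    then have "?y \<in> normalizer G P" using normalizer_mem_iff[OF P] yG by blast
    then have "\<rho> ?y = 1\<^sub>m n" using norm yB BP by blast
    moreover have "b = a \<otimes> ?y" using aG bG by (simp add: mult_inv_cancel)
    ultimately show ?thesis using rm[OF aG yG] ra by simp
  qed
  have eq: "{M \<in> \<rho> ` B. \<forall>g\<in>P. \<rho> g * M = M * \<rho> g} = {1\<^sub>m n}"
  proof
    have "1\<^sub>m n \<in> \<rho> ` B" using r1 B.one_closed by (metis imageI)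
    moreover have "\<rho> g * 1\<^sub>m n = 1\<^sub>m n * \<rho> g" if "g \<in> P" for g
      using rc[OF P.mem_carrier[OF that]] by simp
    ultimately show "{1\<^sub>m n} \<subseteq> {M \<in> \<rho> ` B. \<forall>g\<in>P. \<rho> g * M = M * \<rho> g}" by blast
    show "{M \<in> \<rho> ` B. \<forall>g\<in>P. \<rho> g * M = M * \<rho> g} \<subseteq> {1\<^sub>m n}" using fixed by blast
  qed
  have trinv: "mat_trace (\<rho> g * \<rho> b * \<rho> (inv g)) = mat_trace (\<rho> b)" if "g \<in> P" "b \<in> B" for g b
    using that representation_inv(1)[OF r] rc by (intro mat_trace_conj) auto
  obtain T c where T: "T \<subseteq> \<rho> ` B" and
    s: "(\<Sum>M\<in>\<rho> ` B. mat_trace M) = (\<Sum>M\<in>{M \<in> \<rho> ` B. \<forall>g\<in>P. \<rho> g * M = M * \<rho> g}. mat_trace M)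
        + of_nat p * (\<Sum>M\<in>T. of_nat (c M) * mat_trace M)"
    by (rule conjugation_class_sum[OF p P pP B finB r, where f = mat_trace]) (erule (1) trinv, rule that)
  note s = s[unfolded eq]
  have "(\<Sum>M\<in>\<rho> ` B. mat_trace M) \<noteq> 0"
  proof
    assume z: "(\<Sum>M\<in>\<rho> ` B. mat_trace M) = 0"
    \<comment> \<open>If the sum were \<open>0\<close>, the class equation would read \<open>n = p * y\<close> with a cyclotomic integer \<open>y\<close>.\<close>
    define y where "y = (\<Sum>M\<in>T. of_int (- int (c M)) * mat_trace M)"
    have "y \<in> cyclotomic_integers (card (carrier G))" unfolding y_def
    proof (intro cyclotomic_integers_sum cyclotomic_integers_smult)
      fix M assume "M \<in> T"
      then obtain b where "b \<in> B" "M = \<rho> b" using T by blast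
      then show "mat_trace M \<in> cyclotomic_integers (card (carrier G))"
        using representation_trace_cyclotomic[OF fin r, of b] by simp
    qed
    moreover have "of_nat n = of_nat p * y"
    proof -
      have "y = - (\<Sum>M\<in>T. of_nat (c M) * mat_trace M)" by (simp add: y_def sum_negf)
      then show ?thesis using s z by (simp add: mat_trace_one add_eq_0_iff)
    qed
    ultimately show False using cyclotomic_integer_dvd[OF N _ _ p0] pn by blast
  qed
  moreover have "card {x \<in> B. \<rho> x = 1\<^sub>m n} \<noteq> 0"
  proof -
    have "\<one> \<in> {x \<in> B. \<rho> x = 1\<^sub>m n}" using r1 B.one_closed by blast
    moreover have "finite {x \<in> B. \<rho> x = 1\<^sub>m n}" using finB by simp
    ultimately show ?thesis using card_0_eq by blast
  qed
  ultimately have "(\<Sum>x\<in>B. mat_trace (\<rho> x)) \<noteq> 0"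
    using representation_fibre_sum[OF r Bs finB, of mat_trace] by simp
  then show ?thesis using irreducible_normal_trace_sum[OF irr B _ x] by blast
qed

text \<open>Restricted to \<open>P\<close>, the representation has degree prime to \<open>p\<close>, and the irreducible representations of
\<open>P\<close> of such degrees are trivial on \<open>P \<inter> B\<close>. So \<open>P \<inter> B\<close> fixes a nonzero vector; as \<open>A\<close> acts trivially and
\<open>B \<subseteq> AP\<close>, the same vector is fixed by \<open>B\<close>.\<close>

lemma (in group) p_section_acts_trivially:
  assumes fin: "finite (carrier G)" and p: "Factorial_Ring.prime p"
    and P: "subgroup P G" and pP: "card P = p ^ k"
    and irr: "irreducible_representation G n \<rho>" and pn: "\<not> p dvd n"
    and B: "B \<lhd> G" and PB: "P \<inter> B \<subseteq> derived G P"
    and A: "A \<subseteq> B" "\<And>x. x \<in> A \<Longrightarrow> \<rho> x = 1\<^sub>m n" and gen: "B \<subseteq> A <#> P" and x: "x \<in> B"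
  shows "\<rho> x = 1\<^sub>m n"
proof -
  interpret P: subgroup P G by (rule P)
  interpret B: normal B G by (rule B)
  interpret PG: group "G\<lparr>carrier := P\<rparr>" using P by (rule subgroup_imp_group)
  have r: "representation G n \<rho>" using irr by (simp add: irreducible_representation_def)
  have Bs: "subgroup B G" using B normal_imp_subgroup by blast
  have finP: "finite P" using fin P.subset finite_subset by blast
  have Qs: "subgroup (P \<inter> B) G" using P Bs subgroups_Inter_pair by blast
  have Qn: "P \<inter> B \<lhd> G\<lparr>carrier := P\<rparr>"
  proof (rule PG.normal_invI)
    show "subgroup (P \<inter> B) (G\<lparr>carrier := P\<rparr>)" using subgroup_incl[OF Qs P] by simp
    show "g \<otimes>\<^bsub>G\<lparr>carrier := P\<rparr>\<^esub> h \<otimes>\<^bsub>G\<lparr>carrier := P\<rparr>\<^esub> inv\<^bsub>G\<lparr>carrier := P\<rparr>\<^esub> g \<in> P \<inter> B"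
      if "g \<in> carrier (G\<lparr>carrier := P\<rparr>)" "h \<in> P \<inter> B" for g h
      using that m_inv_consistent[OF P] B.inv_op_closed2[of g h] by auto
  qed
  have "(\<Sum>x\<in>P \<inter> B. mat_trace (\<rho> x)) \<noteq> 0"
  proof (rule PG.normal_trace_sum_nonzero[OF _ representation_restrict[OF r P] Qn pn])
    show "finite (carrier (G\<lparr>carrier := P\<rparr>))" using finP by simp
    fix m \<sigma> x
    assume s: "irreducible_representation (G\<lparr>carrier := P\<rparr>) m \<sigma>" "\<not> p dvd m" and x: "x \<in> P \<inter> B"
    have "x \<in> derived (G\<lparr>carrier := P\<rparr>) P"
      using x PB derived_consistent[OF subset_refl P] by blast
    then show "\<sigma> x = 1\<^sub>m m"
      using PG.p_group_irreducible_derived[OF p _ s] pP by simp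
  qed
  then obtain v where v: "v \<in> carrier_vec n" "v \<noteq> 0\<^sub>v n" "\<And>x. x \<in> P \<inter> B \<Longrightarrow> \<rho> x *\<^sub>v v = v"
    using trace_sum_fixed_vector[OF r Qs] by metis
  have "\<rho> b *\<^sub>v v = v" if b: "b \<in> B" for b
  proof -
    obtain a z where az: "a \<in> A" "z \<in> P" "b = a \<otimes> z" using b gen by (auto simp: set_mult_def)
    have aB: "a \<in> B" using az A by blast
    have G: "a \<in> carrier G" "z \<in> carrier G" using az aB by auto
    have "z = inv a \<otimes> b" using az G by (simp add: mult_inv_cancel)
    then have "z \<in> P \<inter> B" using aB b az by blast
    then have "\<rho> z *\<^sub>v v = v" using v by blast
    moreover have "\<rho> b = \<rho> z" using A(2)[OF az(1)] az(3) representationD(2)[OF r G] representationD(1)[OF r G(2)] by simp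
    ultimately show ?thesis by simp
  qed
  then show ?thesis using irreducible_fixed_vector[OF irr B v(1,2) _ x] by blast
qed

text \<open>Write \<open>A = N \<inter> H\<close> and \<open>B = N \<inter> H'\<close>. The index of \<open>AP\<close> in \<open>BP\<close> is prime to \<open>p\<close>, because \<open>AP\<close> contains the
Sylow subgroup \<open>P\<close>. It is also a power of \<open>p\<close>, because \<open>B/A\<close> embeds into \<open>H'/H\<close>. Hence \<open>AP = BP\<close>. In the
proof, \<open>u\<close> and \<open>v\<close> are the indices of \<open>P\<close> in \<open>AP\<close> and in \<open>BP\<close>.\<close>

lemma (in group) section_p_group_supplement:
  assumes fin: "finite (carrier G)" and p: "Factorial_Ring.prime p"
    and P: "subgroup P G" and pP: "card P = p ^ k" and index: "card (carrier G) = q * card P" "\<not> p dvd q"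
    and N: "N \<lhd> G" and H: "H \<lhd> G" and H': "H' \<lhd> G" and HH: "H \<subseteq> H'"
    and sec: "card H' = p ^ j * card H"
  shows "N \<inter> H' \<subseteq> (N \<inter> H) <#> P"
proof -
  define A where "A = N \<inter> H"
  define B where "B = N \<inter> H'"
  have An: "A \<lhd> G" and Bn: "B \<lhd> G" using N H H' normal_subgroup_intersect by (auto simp: A_def B_def)
  have As: "subgroup A G" and Bs: "subgroup B G" and Hs: "subgroup H G" and Hs': "subgroup H' G"
    using An Bn H H' normal_imp_subgroup by auto
  have pos: "card S > 0" if "subgroup S G" for S
    using subgroup.one_closed[OF that] finite_subset[OF subgroup.subset[OF that] fin] card_gt_0_iff by blast
  have BH: "B \<inter> H = A" using HH by (auto simp: A_def B_def)
  have AB: "A \<subseteq> B" using HH by (auto simp: A_def B_def)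
  have e: "card (B <#> H) * card A = card B * card H"
    using card_set_mult[OF fin Bs Hs] BH by simp
  have "card (B <#> H) dvd card H'"
  proof (rule card_subgroup_dvd[OF mult_norm_subgroup[OF Bn Hs] Hs'])
    show "B <#> H \<subseteq> H'" using HH subgroup.m_closed[OF Hs'] by (auto simp: set_mult_def B_def)
  qed
  then have "card B * card H dvd card H' * card A"
    unfolding e[symmetric] by (rule mult_dvd_mono) simp
  then have "card B * card H dvd p ^ j * card A * card H" by (simp add: sec mult_ac)
  then have dB: "card B dvd p ^ j * card A" using pos[OF Hs] by simp
  define U where "U = A <#> P"
  define V where "V = B <#> P"
  have Us: "subgroup U G" and Vs: "subgroup V G"
    using mult_norm_subgroup[OF An P] mult_norm_subgroup[OF Bn P] by (auto simp: U_def V_def)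
  have UV: "U \<subseteq> V" using AB by (auto simp: U_def V_def set_mult_def)
  have PU: "P \<subseteq> U"
  proof
    fix z assume z: "z \<in> P"
    then have "z = \<one> \<otimes> z" using subgroup.mem_carrier[OF P] by simp
    then show "z \<in> U" using z subgroup.one_closed[OF As] unfolding U_def set_mult_def by blast
  qed
  obtain u where u: "card U = card P * u" using card_subgroup_dvd[OF P Us PU] by (elim dvdE)
  obtain v where v: "card V = card P * v" using card_subgroup_dvd[OF P Vs] PU UV by (meson dvdE subset_trans)
  have cU: "u * card (A \<inter> P) = card A"
    using card_set_mult[OF fin As P] u pos[OF P] by (simp add: U_def mult_ac)
  have cV: "v * card (B \<inter> P) = card B"
    using card_set_mult[OF fin Bs P] v pos[OF P] by (simp add: V_def mult_ac)
  have "card V dvd card (carrier G)"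
    using card_subgroup_dvd[OF Vs subgroup_self subgroup.subset[OF Vs]] .
  then have "v dvd q" using v index pos[OF P] by (simp add: mult.commute)
  then have pv: "\<not> p dvd v" using index dvd_trans by blast
  have "card (A \<inter> P) dvd p ^ k"
    using card_subgroup_dvd[OF subgroups_Inter_pair[OF As P] P] pP by simp
  then obtain i where i: "card (A \<inter> P) = p ^ i" using divides_primepow_nat[OF p] by blast
  have "v dvd p ^ j * (u * p ^ i)"
  proof -
    have "v dvd card B" using cV by (metis dvd_triv_left)
    then show ?thesis using dB cU i dvd_trans by metis
  qed
  then have "v dvd p ^ (j + i) * u" by (simp add: power_add mult_ac)
  moreover have "coprime v (p ^ (j + i))"
  proof -
    have "coprime v p" using prime_imp_coprime[OF p pv] coprime_commute by blast
    then show ?thesis by simp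
  qed
  ultimately have "v dvd u" using coprime_dvd_mult_right_iff by blast
  moreover have "u > 0" using pos[OF Us] u by (cases u) auto
  ultimately have "card V \<le> card U" using u v by (simp add: dvd_imp_le)
  moreover have "finite V" using finite_subset[OF subgroup.subset[OF Vs] fin] .
  ultimately have "U = V" using UV card_seteq by blast
  moreover have "B \<subseteq> V"
  proof
    fix b assume b: "b \<in> B"
    then have "b = b \<otimes> \<one>" using subgroup.mem_carrier[OF Bs] by simp
    then show "b \<in> V" using b subgroup.one_closed[OF P] unfolding V_def set_mult_def by blast
  qed
  ultimately show ?thesis by (simp add: U_def A_def B_def)
qed

text \<open>The index of \<open>P \<inter> H\<close> in \<open>P \<inter> H'\<close> is a power of \<open>p\<close> that divides \<open>|H' : H|\<close>, hence \<open>1\<close>.\<close>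

lemma (in group) section_p'_group_sylow:
  assumes fin: "finite (carrier G)" and p: "Factorial_Ring.prime p"
    and P: "subgroup P G" and pP: "card P = p ^ k"
    and H: "H \<lhd> G" and H': "subgroup H' G" and HH: "H \<subseteq> H'"
    and sec: "card H' = s * card H" "\<not> p dvd s"
  shows "P \<inter> H' \<subseteq> H"
proof -
  have Hs: "subgroup H G" using H normal_imp_subgroup by blast
  have pos: "card S > 0" if "subgroup S G" for S
    using subgroup.one_closed[OF that] finite_subset[OF subgroup.subset[OF that] fin] card_gt_0_iff by blast
  have Q: "subgroup (P \<inter> H') G" using subgroups_Inter_pair[OF P H'] .
  have Q': "subgroup (P \<inter> H) G" using subgroups_Inter_pair[OF P Hs] .
  have "H \<inter> (P \<inter> H') = P \<inter> H" using HH by auto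
  then have e: "card (H <#> (P \<inter> H')) * card (P \<inter> H) = card H * card (P \<inter> H')"
    using card_set_mult[OF fin Hs Q] by simp
  have "card (H <#> (P \<inter> H')) dvd card H'"
  proof (rule card_subgroup_dvd[OF mult_norm_subgroup[OF H Q] H'])
    show "H <#> (P \<inter> H') \<subseteq> H'" using HH subgroup.m_closed[OF H'] by (auto simp: set_mult_def)
  qed
  then have "card H * card (P \<inter> H') dvd card H' * card (P \<inter> H)"
    unfolding e[symmetric] by (rule mult_dvd_mono) simp
  then have "card H * card (P \<inter> H') dvd card H * (s * card (P \<inter> H))" by (simp add: sec mult_ac)
  then have "card (P \<inter> H') dvd s * card (P \<inter> H)" using pos[OF Hs] by simp
  moreover have "coprime (card (P \<inter> H')) s"
  proof -
    have "card (P \<inter> H') dvd p ^ k" using card_subgroup_dvd[OF Q P] pP by simp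
    then obtain i where "card (P \<inter> H') = p ^ i" using divides_primepow_nat[OF p] by blast
    then show ?thesis using prime_imp_coprime[OF p sec(2)] by simp
  qed
  ultimately have "card (P \<inter> H') dvd card (P \<inter> H)" using coprime_dvd_mult_right_iff by blast
  then have "card (P \<inter> H') \<le> card (P \<inter> H)" using pos[OF Q'] by (simp add: dvd_imp_le)
  moreover have "P \<inter> H \<subseteq> P \<inter> H'" using HH by auto
  moreover have "finite (P \<inter> H')" using finite_subset[OF subgroup.subset[OF Q] fin] .
  ultimately have "P \<inter> H = P \<inter> H'" using card_seteq by blast
  then show ?thesis by blast
qed

text \<open>Induction along the series: \<open>N \<inter> H i\<close> acts trivially for all \<open>i\<close>. Since \<open>P\<close> normalizes itself, the
hypothesis \<open>norm\<close> contains \<open>N \<inter> P \<subseteq> P'\<close>, which is what a section of \<open>p\<close>-power order requires.\<close>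

lemma (in group) normalizer_condition_acts_trivially:
  assumes fin: "finite (carrier G)" and p: "Factorial_Ring.prime p" and solv: "p_solvable p G"
    and P: "subgroup P G" and pP: "card P = p ^ k" and index: "card (carrier G) = q * card P" "\<not> p dvd q"
    and N: "N \<lhd> G" and norm: "N \<inter> normalizer G P \<subseteq> derived G P"
    and irr: "irreducible_representation G n \<rho>" and pn: "\<not> p dvd n"
    and x: "x \<in> N"
  shows "\<rho> x = 1\<^sub>m n"
proof -
  have r: "representation G n \<rho>" using irr by (simp add: irreducible_representation_def)
  obtain m H where H0: "H 0 = {\<one>}" and Hm: "H m = carrier G" and Hn: "\<And>i. i \<le> m \<Longrightarrow> H i \<lhd> G"
    and step: "\<And>i. i < m \<Longrightarrow> H i \<subseteq> H (Suc i) \<and>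
       ((\<exists>k. Coset.order (G\<lparr>carrier := H (Suc i)\<rparr> Mod H i) = p ^ k) \<or>
        \<not> p dvd Coset.order (G\<lparr>carrier := H (Suc i)\<rparr> Mod H i))"
    using solv unfolding p_solvable_def by blast
  have PN: "P \<subseteq> normalizer G P"
    using subgroup_in_normalizer[OF P] normal_imp_subgroup subgroup.subset by fastforce
  have DP: "derived G P \<subseteq> P" using derived_incl[OF subset_refl P] .
  have "\<rho> y = 1\<^sub>m n" if "i \<le> m" "y \<in> N \<inter> H i" for i y
    using that
  proof (induction i arbitrary: y)
    case 0
    then show ?case using H0 representationD(3)[OF r] by auto
  next
    case (Suc i)
    let ?B = "N \<inter> H (Suc i)" and ?A = "N \<inter> H i"
    define s where "s = Coset.order (G\<lparr>carrier := H (Suc i)\<rparr> Mod H i)"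
    have im: "i < m" using Suc.prems by simp
    have H1: "H i \<lhd> G" "H (Suc i) \<lhd> G" and HH: "H i \<subseteq> H (Suc i)"
      using Hn step[OF im] im by auto
    have Hs: "subgroup (H i) G" "subgroup (H (Suc i)) G" using H1 normal_imp_subgroup by auto
    interpret HG: group "G\<lparr>carrier := H (Suc i)\<rparr>" using Hs(2) by (rule subgroup_imp_group)
    have sec: "card (H (Suc i)) = s * card (H i)"
      using HG.lagrange[OF subgroup_incl[OF Hs HH]] by (simp add: s_def Coset.order_def FactGroup_def)
    have Bn: "?B \<lhd> G" using N H1 normal_subgroup_intersect by blast
    have A: "?A \<subseteq> ?B" using HH by auto
    have kerA: "\<And>y. y \<in> ?A \<Longrightarrow> \<rho> y = 1\<^sub>m n" using Suc.IH im by simp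
    consider j where "s = p ^ j" | "\<not> p dvd s" using step[OF im] s_def by blast
    then show ?case
    proof cases
      case 1
      show ?thesis
      proof (rule p_section_acts_trivially[OF fin p P pP irr pn Bn _ A kerA])
        show "P \<inter> ?B \<subseteq> derived G P" using PN norm by blast
        show "?B \<subseteq> ?A <#> P"
          by (rule section_p_group_supplement[where j = j, OF fin p P pP index N H1 HH]) (use sec 1 in simp)
      qed (use Suc.prems in auto)
    next
      case 2
      have "P \<inter> H (Suc i) \<subseteq> H i"
        by (rule section_p'_group_sylow[OF fin p P pP H1(1) Hs(2) HH sec 2])
      then have "\<And>y. y \<in> P \<inter> ?B \<Longrightarrow> \<rho> y = 1\<^sub>m n" using kerA by blast
      moreover have "?B \<inter> normalizer G P \<subseteq> P" using norm DP by blast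
      ultimately show ?thesis
        using coprime_section_acts_trivially[OF fin p P pP index irr pn Bn] Suc.prems(2) by blast
    qed
  qed
  from this[of m x] show ?thesis using Hm x normal_imp_subgroup[OF N] subgroup.subset by auto
qed

section \<open>The intersection of the kernels\<close>

text \<open>The set of characters intersected over is not empty, so the intersection is contained in \<open>G\<close>.\<close>

lemma (in group) exists_irreducible_p'_degree:
  assumes "Factorial_Ring.prime (p::nat)"
  obtains m \<sigma> where "irreducible_representation G m \<sigma>" "\<not> p dvd m"
proof -
  have "representation G 1 (\<lambda>_. 1\<^sub>m 1)" by (rule representationI) auto
  from composition_factors[OF this] obtain L where
    irr: "\<forall>(m,\<sigma>)\<in>set L. irreducible_representation G m \<sigma> \<and> (\<forall>g\<in>carrier G. 1\<^sub>m 1 = (1\<^sub>m 1 :: complex mat) \<longrightarrow> \<sigma> g = 1\<^sub>m m)"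
    and n: "1 = (\<Sum>(m,\<sigma>)\<leftarrow>L. m)" by (elim exE conjE) (rule that)
  have "\<exists>a\<in>set L. \<not> p dvd fst a"
  proof (rule ccontr)
    assume "\<not> ?thesis"
    then have "p dvd (\<Sum>a\<leftarrow>L. fst a)" by (intro dvd_sum_list) blast
    then have "p dvd 1" using n by (simp add: case_prod_unfold)
    then show False using assms by (simp add: prime_nat_iff)
  qed
  then obtain a where a: "a \<in> set L" "\<not> p dvd fst a" by blast
  then have "irreducible_representation G (fst a) (snd a)" using irr by (simp add: case_prod_unfold)
  then show ?thesis using that a(2) by blast
qed

lemma (in group) character_kernels_eq:
  assumes fin: "finite (carrier G)" and p: "Factorial_Ring.prime p"
  shows "(\<Inter>\<chi> \<in> {\<chi> \<in> Irr G. \<not> p dvd char_degree G \<chi>}. char_kernel G \<chi>) =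
    {g \<in> carrier G. \<forall>n \<rho>. irreducible_representation G n \<rho> \<longrightarrow> \<not> p dvd n \<longrightarrow> \<rho> g = 1\<^sub>m n}"
    (is "?L = ?R")
proof -
  have ker: "char_kernel G (character_of G \<rho>) = {g \<in> carrier G. \<rho> g = 1\<^sub>m n}"
    if "irreducible_representation G n \<rho>" for n \<rho>
  proof -
    have r: "representation G n \<rho>" using that by (simp add: irreducible_representation_def)
    have "mat_trace (\<rho> g) = of_nat n \<longleftrightarrow> \<rho> g = 1\<^sub>m n" if "g \<in> carrier G" for g
      using representation_trace_kernel[OF fin r that] mat_trace_one[of n] by metis
    then show ?thesis
      using representationD(3)[OF r] mat_trace_one[of n]
      unfolding char_kernel_def character_of_def by (intro Collect_cong) simp
  qed
  have deg: "char_degree G (character_of G \<rho>) = n" if "irreducible_representation G n \<rho>" for n \<rho>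
    using that char_degree_character_of by (simp add: irreducible_representation_def)
  obtain m \<sigma> where ms: "irreducible_representation G m \<sigma>" "\<not> p dvd m"
    using exists_irreducible_p'_degree[OF p] by blast
  show ?thesis
  proof
    show "?L \<subseteq> ?R"
    proof
      fix g assume g: "g \<in> ?L"
      have *: "g \<in> carrier G \<and> \<rho> g = 1\<^sub>m n" if "irreducible_representation G n \<rho>" "\<not> p dvd n" for n \<rho>
      proof -
        have "character_of G \<rho> \<in> {\<chi> \<in> Irr G. \<not> p dvd char_degree G \<chi>}"
          using that deg[OF that(1)] by (auto simp: Irr_def)
        then have "g \<in> char_kernel G (character_of G \<rho>)" using g by blast
        then show ?thesis using ker[OF that(1)] by simp
      qed
      then show "g \<in> ?R" using ms by blast
    qed
    show "?R \<subseteq> ?L"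
    proof (intro subsetI INT_I)
      fix g \<chi> assume g: "g \<in> ?R" and "\<chi> \<in> {\<chi> \<in> Irr G. \<not> p dvd char_degree G \<chi>}"
      then obtain n \<rho> where "irreducible_representation G n \<rho>" "\<chi> = character_of G \<rho>" "\<not> p dvd n"
        using deg by (auto simp: Irr_def)
      then show "g \<in> char_kernel G \<chi>" using g ker by auto
    qed
  qed
qed

lemma (in group) representation_kernels_normal:
  "{g \<in> carrier G. \<forall>n \<rho>. irreducible_representation G n \<rho> \<longrightarrow> \<not> p dvd n \<longrightarrow> \<rho> g = 1\<^sub>m n} \<lhd> G"
    (is "?K \<lhd> G")
proof (rule normal_invI)
  have r: "representation G n \<rho>" if "irreducible_representation G n \<rho>" for n \<rho>
    using that by (simp add: irreducible_representation_def)
  have inv: "\<rho> (inv g) = 1\<^sub>m n" if "irreducible_representation G n \<rho>" "g \<in> carrier G" "\<rho> g = 1\<^sub>m n" for n \<rho> g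
    using representation_inv(1)[OF r[OF that(1)] that(2)] representationD(1)[OF r[OF that(1)], of "inv g"] that by simp
  show "subgroup ?K G"
  proof (rule subgroupI)
    have "\<one> \<in> ?K" using representationD(3)[OF r] by simp
    then show "?K \<noteq> {}" by (metis empty_iff)
    show "inv a \<in> ?K" if a: "a \<in> ?K" for a
    proof -
      have "\<rho> (inv a) = 1\<^sub>m n" if i: "irreducible_representation G n \<rho>" "\<not> p dvd n" for n \<rho>
        by (rule inv[OF i(1)]) (use a i in simp_all)
      then show ?thesis using a by simp
    qed
    show "a \<otimes> b \<in> ?K" if ab: "a \<in> ?K" "b \<in> ?K" for a b
    proof -
      have "\<rho> (a \<otimes> b) = 1\<^sub>m n" if i: "irreducible_representation G n \<rho>" "\<not> p dvd n" for n \<rho>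
      proof -
        have "\<rho> a = 1\<^sub>m n" "\<rho> b = 1\<^sub>m n" using ab i by blast+
        then show ?thesis using representationD(2)[OF r[OF i(1)], of a b] ab by simp
      qed
      then show ?thesis using ab by simp
    qed
  qed simp
  show "g \<otimes> h \<otimes> inv g \<in> ?K" if gh: "g \<in> carrier G" "h \<in> ?K" for g h
  proof -
    have "\<rho> (g \<otimes> h \<otimes> inv g) = 1\<^sub>m n" if i: "irreducible_representation G n \<rho>" "\<not> p dvd n" for n \<rho>
    proof -
      have "\<rho> h = 1\<^sub>m n" "h \<in> carrier G" using gh i by auto
      then show ?thesis
        using representationD(2)[OF r[OF i(1)]] representation_inv(2)[OF r[OF i(1)] gh(1)] gh(1)
          right_mult_one_mat[OF representationD(1)[OF r[OF i(1)] gh(1)]] by simp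
    qed
    then show ?thesis using gh by simp
  qed
qed

theorem theoremC:
  fixes G :: "('a, 'b) monoid_scheme" and p :: nat and P :: "'a set"
  assumes "Factorial_Ring.prime p"
    and "group G" and "finite (carrier G)" and "p_solvable p G"
    and "sylow_subgroup p P G"
  shows "largest_normal_subgroup G (\<lambda>N. N \<inter> normalizer G P \<subseteq> derived G P)
           (\<Inter>\<chi> \<in> {\<chi> \<in> Irr G. \<not> p dvd char_degree G \<chi>}. char_kernel G \<chi>)"
proof -
  interpret group G by (rule assms(2))
  note p = assms(1) and fin = assms(3)
  have P: "subgroup P G" and cP: "card P = p ^ multiplicity p (Coset.order G)"
    using assms(5) by (auto simp: sylow_subgroup_def)
  have "Coset.order G \<noteq> 0" using fin order_gt_0_iff_finite by simp
  moreover have "\<not> is_unit p" using p by (simp add: prime_nat_iff)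
  ultimately obtain q where q: "Coset.order G = p ^ multiplicity p (Coset.order G) * q" "\<not> p dvd q"
    using multiplicity_decompose' by blast
  have index: "card (carrier G) = q * card P" using q cP by (simp add: Coset.order_def mult.commute)
  define K where "K = {g \<in> carrier G. \<forall>n \<rho>. irreducible_representation G n \<rho> \<longrightarrow> \<not> p dvd n \<longrightarrow> \<rho> g = 1\<^sub>m n}"
  have K: "K \<lhd> G" unfolding K_def by (rule representation_kernels_normal)
  have "K \<inter> normalizer G P \<subseteq> derived G P"
    by (rule normalizer_inter_le_derived[OF fin K _ P index q(2)]) (auto simp: K_def)
  moreover have "N \<subseteq> K" if N: "N \<lhd> G" "N \<inter> normalizer G P \<subseteq> derived G P" for N
  proof
    fix x assume x: "x \<in> N"
    have "x \<in> carrier G" by (rule subgroup.mem_carrier[OF normal_imp_subgroup[OF N(1)] x])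
    moreover have "\<rho> x = 1\<^sub>m n" if "irreducible_representation G n \<rho>" "\<not> p dvd n" for n \<rho>
      by (rule normalizer_condition_acts_trivially[OF fin p assms(4) P cP index q(2) N that x])
    ultimately show "x \<in> K" by (simp add: K_def)
  qed
  ultimately show ?thesis
    using K by (simp add: largest_normal_subgroup_def character_kernels_eq[OF fin p] K_def[symmetric])
qed

end
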